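(* For a path-connected topological space $X$, we have $$\mathrm{cl}_R^m(X)\le \mathrm{cat}_m(X)$$ for all integers $m\ge 1$ and any commutative ring $R$.
   Context: For a topological space $X$, the $m$-category $\mathrm{cat}_m(X)$ is the least integer $k$ such that $X$ admits an open cover $\{U_i\}_{i=0}^k$ such that, for each $i$ and every map $\phi\colon P\to U_i$ from an $m$-dimensional CW complex $P$, the composition $\iota_{U_i}\circ\phi\colon P\to X$ is nullhomotopic (homotopic to a constant map), where $\iota_{U_i}\colon U_i\hookrightarrow X$ is the inclusion. For a commutative ring $R$ with unity and $m\ge1$, the $m$-cup length $\mathrm{cl}_R^m(X)$ is the largest integer $k\ge 0$ such that there exist (homogeneous) cohomology classes $u_1,\dots,u_k\in\widetilde H^*(X;R)$ with $1\le\deg(u_i)\le m$ for all $i$ and $u_1\smile\cdots\smile u_k\neq 0$. If $X$ has no nonzero cohomology class of degree between $1$ and $m$, then $\mathrm{cl}_R^m(X)=0$. *)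

theory Defs
  imports "HOL-Homology.Homology" "HOL-Library.Extended_Nat"
begin

section \<open>Singular cohomology and the cup product\<close>

text \<open>
  The coefficient ring has the sort \<open>{comm_ring, comm_monoid_mult}\<close>: a commutative ring with unity
  in which \<open>0 = 1\<close> is not excluded, in contrast to \<open>comm_ring_1\<close>.

  A \<open>p\<close>-cochain is a function on singular \<open>p\<close>-simplices. As the simplices of \<open>X\<close> do not form a type,
  it is normalised to vanish on everything else, so that equality of cochains is equality in HOL.
\<close>

type_synonym 'a simplex = "(nat \<Rightarrow> real) \<Rightarrow> 'a"
type_synonym ('a, 'r) cochain = "'a simplex \<Rightarrow> 'r"

definition singular_cochains :: "nat \<Rightarrow> 'a topology \<Rightarrow> ('a, 'r::{comm_ring, comm_monoid_mult}) cochain set" where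
  "singular_cochains p X = {c. \<forall>\<sigma>. \<not> singular_simplex p X \<sigma> \<longrightarrow> c \<sigma> = 0}"

definition coboundary :: "nat \<Rightarrow> 'a topology \<Rightarrow> ('a, 'r::{comm_ring, comm_monoid_mult}) cochain \<Rightarrow> ('a, 'r) cochain" where
  "coboundary p X c = (\<lambda>\<sigma>. if singular_simplex (Suc p) X \<sigma>
     then (\<Sum>k\<le>Suc p. (-1) ^ k * c (singular_face (Suc p) k \<sigma>)) else 0)"

definition singular_cocycles :: "nat \<Rightarrow> 'a topology \<Rightarrow> ('a, 'r::{comm_ring, comm_monoid_mult}) cochain set" where
  "singular_cocycles p X = {c \<in> singular_cochains p X. coboundary p X c = (\<lambda>\<sigma>. 0)}"

definition singular_coboundaries :: "nat \<Rightarrow> 'a topology \<Rightarrow> ('a, 'r::{comm_ring, comm_monoid_mult}) cochain set" where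
  "singular_coboundaries p X =
     (case p of 0 \<Rightarrow> {\<lambda>\<sigma>. 0} | Suc q \<Rightarrow> coboundary q X ` singular_cochains q X)"

definition cohomologous :: "nat \<Rightarrow> 'a topology \<Rightarrow> (('a, 'r::{comm_ring, comm_monoid_mult}) cochain \<times> ('a, 'r) cochain) set" where
  "cohomologous p X = {(a, b). a \<in> singular_cocycles p X \<and> b \<in> singular_cocycles p X \<and>
     (\<lambda>\<sigma>. a \<sigma> - b \<sigma>) \<in> singular_coboundaries p X}"

definition cohomology :: "nat \<Rightarrow> 'a topology \<Rightarrow> ('a, 'r::{comm_ring, comm_monoid_mult}) cochain set set" where
  "cohomology p X = singular_cocycles p X // cohomologous p X"

definition cohomology_class :: "nat \<Rightarrow> 'a topology \<Rightarrow> ('a, 'r::{comm_ring, comm_monoid_mult}) cochain \<Rightarrow> ('a, 'r) cochain set" where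
  "cohomology_class p X c = cohomologous p X `` {c}"

definition zero_class :: "nat \<Rightarrow> 'a topology \<Rightarrow> ('a, 'r::{comm_ring, comm_monoid_mult}) cochain set" where
  "zero_class p X = cohomology_class p X (\<lambda>\<sigma>. 0)"

definition unit_class :: "'a topology \<Rightarrow> ('a, 'r::{comm_ring, comm_monoid_mult}) cochain set" where
  "unit_class X = cohomology_class 0 X (\<lambda>\<sigma>. if singular_simplex 0 X \<sigma> then 1 else 0)"

text \<open>The restrictions of a \<open>(p + q)\<close>-simplex to the faces \<open>[v\<^sub>0, ..., v\<^sub>p]\<close> and \<open>[v\<^sub>p, ..., v\<^sub>p\<^sub>+\<^sub>q]\<close>.\<close>

definition front_face :: "nat \<Rightarrow> 'a simplex \<Rightarrow> 'a simplex" where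
  "front_face p \<sigma> = restrict \<sigma> (standard_simplex p)"

definition back_face :: "nat \<Rightarrow> nat \<Rightarrow> 'a simplex \<Rightarrow> 'a simplex" where
  "back_face p q \<sigma> = restrict (\<lambda>x. \<sigma> (\<lambda>i. if i < p then 0 else x (i - p))) (standard_simplex q)"

definition cup_cochain :: "'a topology \<Rightarrow> nat \<Rightarrow> nat \<Rightarrow> ('a, 'r::{comm_ring, comm_monoid_mult}) cochain
    \<Rightarrow> ('a, 'r) cochain \<Rightarrow> ('a, 'r) cochain" where
  "cup_cochain X p q a b = (\<lambda>\<sigma>. if singular_simplex (p + q) X \<sigma>
     then a (front_face p \<sigma>) * b (back_face p q \<sigma>) else 0)"

text \<open>
  The union runs over all representatives; each contributes the same class, see \<open>cup_cohomology_class\<close>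
  below.
\<close>

definition cup :: "'a topology \<Rightarrow> nat \<Rightarrow> nat \<Rightarrow> ('a, 'r::{comm_ring, comm_monoid_mult}) cochain set
    \<Rightarrow> ('a, 'r) cochain set \<Rightarrow> ('a, 'r) cochain set" where
  "cup X p q u v = (\<Union>a\<in>u. \<Union>b\<in>v. cohomology_class (p + q) X (cup_cochain X p q a b))"

text \<open>A homogeneous class is paired with its degree; the empty product is the unit of \<open>H\<^sup>0(X)\<close>.\<close>

fun cup_list :: "'a topology \<Rightarrow> (nat \<times> ('a, 'r::{comm_ring, comm_monoid_mult}) cochain set) list
    \<Rightarrow> ('a, 'r) cochain set" where
  "cup_list X [] = unit_class X"
| "cup_list X ((p, u) # us) = cup X p (sum_list (map fst us)) u (cup_list X us)"

text \<open>
  Only classes of positive degree enter, where reduced and unreduced cohomology are the same.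
  The length \<open>0\<close> is always admissible unless \<open>H\<^sup>0(X) = 0\<close>, in which case the supremum of the empty set is
  again \<open>0\<close>. The value \<open>\<infinity>\<close> means that there are nonzero products of any length.
\<close>

definition cup_length :: "'r::{comm_ring, comm_monoid_mult} itself \<Rightarrow> nat \<Rightarrow> 'a topology \<Rightarrow> enat" where
  "cup_length R m X = Sup {enat k |k. \<exists>us :: (nat \<times> ('a, 'r) cochain set) list.
     length us = k \<and>
     (\<forall>(p, u) \<in> set us. 1 \<le> p \<and> p \<le> m \<and> u \<in> cohomology p X) \<and>
     cup_list X us \<noteq> zero_class (sum_list (map fst us)) X}"


section \<open>CW complexes and the m-category\<close>

definition disc :: "nat \<Rightarrow> (nat \<Rightarrow> real) topology" where
  "disc n = subtopology (Euclidean_space n) {x. (\<Sum>i<n. x i ^ 2) \<le> 1}"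

definition open_disc :: "nat \<Rightarrow> (nat \<Rightarrow> real) set" where
  "open_disc n = {x \<in> topspace (disc n). (\<Sum>i<n. x i ^ 2) < 1}"

definition disc_boundary :: "nat \<Rightarrow> (nat \<Rightarrow> real) set" where
  "disc_boundary n = {x \<in> topspace (disc n). (\<Sum>i<n. x i ^ 2) = 1}"

text \<open>
  \<open>\<Phi> n\<close> is the set of characteristic maps of the \<open>n\<close>-cells of \<open>P\<close>. The conditions are: the open cells
  partition the Hausdorff space \<open>P\<close>, the boundary of an \<open>n\<close>-cell meets only finitely many cells, all of
  dimension less than \<open>n\<close>, and \<open>P\<close> has the weak topology with respect to the closed cells.
\<close>

definition cw_structure :: "'p topology \<Rightarrow> (nat \<Rightarrow> ((nat \<Rightarrow> real) \<Rightarrow> 'p) set) \<Rightarrow> bool" where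
  "cw_structure P \<Phi> \<longleftrightarrow>
     Hausdorff_space P \<and>
     (\<forall>n. \<forall>f\<in>\<Phi> n. continuous_map (disc n) P f \<and>
        homeomorphic_map (subtopology (disc n) (open_disc n)) (subtopology P (f ` open_disc n)) f) \<and>
     (\<Union>n. \<Union>f\<in>\<Phi> n. f ` open_disc n) = topspace P \<and>
     disjoint_family_on (\<lambda>(n, f). f ` open_disc n) (SIGMA n:UNIV. \<Phi> n) \<and>
     (\<forall>n. \<forall>f\<in>\<Phi> n. \<exists>F. finite F \<and> F \<subseteq> (SIGMA k:{..<n}. \<Phi> k) \<and>
        f ` disc_boundary n \<subseteq> (\<Union>(k, g)\<in>F. g ` open_disc k)) \<and>
     (\<forall>A \<subseteq> topspace P. closedin P A \<longleftrightarrow>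
        (\<forall>n. \<forall>f\<in>\<Phi> n. closedin (disc n) {x \<in> topspace (disc n). f x \<in> A}))"

definition cw_complex_of_dim :: "nat \<Rightarrow> 'p topology \<Rightarrow> bool" where
  "cw_complex_of_dim m P \<longleftrightarrow> (\<exists>\<Phi>. cw_structure P \<Phi> \<and> \<Phi> m \<noteq> {} \<and> (\<forall>n>m. \<Phi> n = {}))"

text \<open>
  HOL cannot quantify over all types inside a definition, so the points of the test complexes are taken
  from one type that depends on \<open>'a\<close>. It is large enough for this to be no restriction. For an open
  \<open>U \<noteq> {}\<close> in \<open>X\<close>, the \<open>m\<close>-skeleton \<open>K\<close> of the geometric realisation of the singular (semi-simplicial)
  set of \<open>U\<close> is an \<open>m\<close>-dimensional CW complex. Its points are triples of a dimension \<open>p \<le> m\<close>, a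
  singular simplex of dimension \<open>p\<close> and an interior point of the standard \<open>p\<close>-simplex, so it can be
  realised on \<open>'a cw_point\<close>. The evaluation map from \<open>K\<close> to \<open>U\<close> is \<open>m\<close>-connected, hence every map from
  an \<open>m\<close>-dimensional CW complex of whatever size to \<open>U\<close> factors through \<open>K\<close> up to homotopy.
\<close>

type_synonym 'a cw_point = "nat \<times> 'a simplex \<times> (nat \<Rightarrow> real)"

definition nullhomotopic :: "'p topology \<Rightarrow> 'a topology \<Rightarrow> ('p \<Rightarrow> 'a) \<Rightarrow> bool" where
  "nullhomotopic P X f \<longleftrightarrow> (\<exists>c. homotopic_with (\<lambda>h. True) P X f (\<lambda>x. c))"

definition m_categorical :: "nat \<Rightarrow> 'a topology \<Rightarrow> 'a set \<Rightarrow> bool" where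
  "m_categorical m X U \<longleftrightarrow>
     (\<forall>(P :: 'a cw_point topology) \<phi>. cw_complex_of_dim m P \<and> continuous_map P (subtopology X U) \<phi>
        \<longrightarrow> nullhomotopic P X \<phi>)"

text \<open>The infimum is \<open>\<infinity>\<close> if no finite cover of this kind exists.\<close>

definition m_cat :: "nat \<Rightarrow> 'a topology \<Rightarrow> enat" where
  "m_cat m X = Inf {enat k |k. \<exists>U :: nat \<Rightarrow> 'a set.
     (\<forall>i\<le>k. openin X (U i) \<and> m_categorical m X (U i)) \<and> (\<Union>i\<le>k. U i) = topspace X}"


section \<open>The cup product is well defined\<close>

lemma front_face_simplex:
  assumes "singular_simplex n X \<sigma>" "p \<le> n"
  shows "singular_simplex p X (front_face p \<sigma>)"
proof -
  have "continuous_map (subtopology (powertop_real UNIV) (standard_simplex p)) X \<sigma>"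
    using assms standard_simplex_mono[of p n] unfolding singular_simplex_def
    by (meson continuous_map_from_subtopology_mono)
  then have "continuous_map (subtopology (powertop_real UNIV) (standard_simplex p)) X
      (restrict \<sigma> (standard_simplex p))"
    by (rule continuous_map_eq) auto
  then show ?thesis by (auto simp: singular_simplex_def front_face_def)
qed

lemma shift_simplex:
  assumes "x \<in> standard_simplex q"
  shows "(\<lambda>i. if i < p then 0 else x (i - p)) \<in> standard_simplex (p + q)"
proof -
  have "(\<Sum>i\<le>p+q. if i < p then 0 else x (i - p)) = (\<Sum>i\<in>{p..p+q}. x (i - p))"
    by (rule sum.mono_neutral_cong_right) auto
  also have "\<dots> = (\<Sum>i\<le>q. x i)"
    by (rule sum.reindex_bij_witness[of _ "\<lambda>i. i + p" "\<lambda>i. i - p"]) auto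
  finally show ?thesis using assms by (auto simp: standard_simplex_def)
qed

lemma back_face_simplex:
  assumes "singular_simplex (p + q) X \<sigma>"
  shows "singular_simplex q X (back_face p q \<sigma>)"
proof -
  let ?s = "\<lambda>x::nat \<Rightarrow> real. \<lambda>i. if i < p then 0 else x (i - p)"
  have "continuous_map (subtopology (powertop_real UNIV) (standard_simplex q)) (powertop_real UNIV) ?s"
    unfolding continuous_map_componentwise_UNIV
  proof
    fix i
    show "continuous_map (subtopology (powertop_real UNIV) (standard_simplex q)) euclideanreal
        (\<lambda>x. ?s x i)"
      by (cases "i < p") (auto intro: continuous_map_from_subtopology continuous_map_product_projection)
  qed
  then have "continuous_map (subtopology (powertop_real UNIV) (standard_simplex q))
      (subtopology (powertop_real UNIV) (standard_simplex (p + q))) ?s"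
    using shift_simplex by (auto simp: continuous_map_in_subtopology)
  then have "continuous_map (subtopology (powertop_real UNIV) (standard_simplex q)) X (\<sigma> \<circ> ?s)"
    using assms unfolding singular_simplex_def by (blast intro: continuous_map_compose)
  then have "continuous_map (subtopology (powertop_real UNIV) (standard_simplex q)) X (back_face p q \<sigma>)"
    unfolding back_face_def by (rule continuous_map_eq) auto
  then show ?thesis by (auto simp: singular_simplex_def back_face_def)
qed

lemma front_face_face_le:
  assumes "k \<le> Suc p" "p \<le> n"
  shows "front_face p (singular_face (Suc n) k \<sigma>) = singular_face (Suc p) k (front_face (Suc p) \<sigma>)"
proof
  fix x
  have "x \<in> standard_simplex p \<Longrightarrow> x \<in> standard_simplex n"
    using standard_simplex_mono assms by blast
  moreover have "x \<in> standard_simplex p \<Longrightarrow> simplical_face k x \<in> standard_simplex (Suc p)"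
    using simplical_face_in_standard_simplex[of "Suc p" k x] assms by simp
  ultimately show "front_face p (singular_face (Suc n) k \<sigma>) x
      = singular_face (Suc p) k (front_face (Suc p) \<sigma>) x"
    by (auto simp: front_face_def singular_face_def)
qed

lemma front_face_face_gt:
  assumes "p < k" "p \<le> n"
  shows "front_face p (singular_face (Suc n) k \<sigma>) = front_face p \<sigma>"
proof
  fix x
  have "x \<in> standard_simplex p \<Longrightarrow> x \<in> standard_simplex n"
    using standard_simplex_mono assms by blast
  moreover have "x \<in> standard_simplex p \<Longrightarrow> simplical_face k x = x"
    using assms by (auto simp: standard_simplex_def simplical_face_def fun_eq_iff)
  ultimately show "front_face p (singular_face (Suc n) k \<sigma>) x = front_face p \<sigma> x"
    by (auto simp: front_face_def singular_face_def)
qed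

lemma back_face_face_le:
  assumes "k \<le> p"
  shows "back_face p q (singular_face (Suc (p + q)) k \<sigma>) = back_face (Suc p) q \<sigma>"
proof
  fix x :: "nat \<Rightarrow> real"
  have "simplical_face k (\<lambda>i. if i < p then 0 else x (i - p)) = (\<lambda>i. if i < Suc p then 0 else x (i - Suc p))"
    using assms by (auto simp: simplical_face_def fun_eq_iff)
  then show "back_face p q (singular_face (Suc (p + q)) k \<sigma>) x = back_face (Suc p) q \<sigma> x"
    using shift_simplex[of x q p] by (auto simp: back_face_def singular_face_def)
qed

lemma back_face_face_ge:
  assumes "j \<le> Suc q"
  shows "back_face p q (singular_face (Suc (p + q)) (p + j) \<sigma>) = singular_face (Suc q) j (back_face p (Suc q) \<sigma>)"
proof
  fix x :: "nat \<Rightarrow> real"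
  have "simplical_face (p + j) (\<lambda>i. if i < p then 0 else x (i - p))
      = (\<lambda>i. if i < p then 0 else simplical_face j x (i - p))"
    by (auto simp: simplical_face_def fun_eq_iff)
  moreover have "x \<in> standard_simplex q \<Longrightarrow> simplical_face j x \<in> standard_simplex (Suc q)"
    using simplical_face_in_standard_simplex[of "Suc q" j x] assms by simp
  ultimately show "back_face p q (singular_face (Suc (p + q)) (p + j) \<sigma>) x
      = singular_face (Suc q) j (back_face p (Suc q) \<sigma>) x"
    using shift_simplex[of x q p] by (auto simp: back_face_def singular_face_def)
qed

lemma coboundary_cup:
  fixes a b :: "('a, 'r::{comm_ring, comm_monoid_mult}) cochain"
  shows "coboundary (p + q) X (cup_cochain X p q a b) =
    (\<lambda>\<sigma>. cup_cochain X (Suc p) q (coboundary p X a) b \<sigma> + (-1) ^ p * cup_cochain X p (Suc q) a (coboundary q X b) \<sigma>)"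
proof
  fix \<sigma> :: "'a simplex"
  let ?n = "Suc (p + q)"
  let ?F = "front_face p \<sigma>" and ?B = "back_face (Suc p) q \<sigma>"
  let ?A = "\<lambda>k. a (singular_face (Suc p) k (front_face (Suc p) \<sigma>))"
  let ?C = "\<lambda>k. b (singular_face (Suc q) k (back_face p (Suc q) \<sigma>))"
  show "coboundary (p + q) X (cup_cochain X p q a b) \<sigma> =
    cup_cochain X (Suc p) q (coboundary p X a) b \<sigma> + (-1) ^ p * cup_cochain X p (Suc q) a (coboundary q X b) \<sigma>"
  proof (cases "singular_simplex ?n X \<sigma>")
    case True
    have sf: "singular_simplex (p + q) X (singular_face ?n k \<sigma>)" if "k \<le> ?n" for k
      using singular_simplex_singular_face[OF True _ that] by simp
    have f1: "singular_simplex (Suc p) X (front_face (Suc p) \<sigma>)"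
      using front_face_simplex[OF True] by simp
    have f2: "singular_simplex (Suc q) X (back_face p (Suc q) \<sigma>)"
      using back_face_simplex[of p "Suc q"] True by simp
    have "coboundary (p + q) X (cup_cochain X p q a b) \<sigma> =
        (\<Sum>k\<le>?n. (-1) ^ k * (a (front_face p (singular_face ?n k \<sigma>)) * b (back_face p q (singular_face ?n k \<sigma>))))"
      unfolding coboundary_def cup_cochain_def using True by (simp add: sf)
    also have "{..?n} = {..p} \<union> {Suc p..?n}" by auto
    also have "(\<Sum>k\<in>{..p} \<union> {Suc p..?n}. (-1) ^ k * (a (front_face p (singular_face ?n k \<sigma>)) * b (back_face p q (singular_face ?n k \<sigma>))))
      = (\<Sum>k\<le>p. (-1) ^ k * (a (front_face p (singular_face ?n k \<sigma>)) * b (back_face p q (singular_face ?n k \<sigma>))))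
      + (\<Sum>k\<in>{Suc p..?n}. (-1) ^ k * (a (front_face p (singular_face ?n k \<sigma>)) * b (back_face p q (singular_face ?n k \<sigma>))))"
      by (rule sum.union_disjoint) auto
    also have "(\<Sum>k\<le>p. (-1) ^ k * (a (front_face p (singular_face ?n k \<sigma>)) * b (back_face p q (singular_face ?n k \<sigma>))))
      = (\<Sum>k\<le>p. (-1) ^ k * (?A k * b ?B))"
      by (rule sum.cong) (auto simp: front_face_face_le back_face_face_le)
    also have "(\<Sum>k\<in>{Suc p..?n}. (-1) ^ k * (a (front_face p (singular_face ?n k \<sigma>)) * b (back_face p q (singular_face ?n k \<sigma>))))
      = (\<Sum>j\<le>q. (-1) ^ (p + Suc j) * (a ?F * ?C (Suc j)))"
    proof (rule sum.reindex_bij_witness[of _ "\<lambda>j. p + Suc j" "\<lambda>k. k - Suc p"])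
      fix k assume k: "k \<in> {Suc p..?n}"
      define j where "j = k - Suc p"
      have j: "k = p + Suc j" "j \<le> q"
        using k by (auto simp: j_def)
      have "back_face p q (singular_face ?n k \<sigma>) = singular_face (Suc q) (Suc j) (back_face p (Suc q) \<sigma>)"
        unfolding j by (rule back_face_face_ge) (use j in simp)
      moreover have "front_face p (singular_face ?n k \<sigma>) = ?F"
        by (rule front_face_face_gt) (use j in auto)
      ultimately show "(-1) ^ (p + Suc (k - Suc p)) * (a ?F * ?C (Suc (k - Suc p))) =
          (-1) ^ k * (a (front_face p (singular_face ?n k \<sigma>)) * b (back_face p q (singular_face ?n k \<sigma>)))"
        using j by simp
    qed auto
    finally have 1: "coboundary (p + q) X (cup_cochain X p q a b) \<sigma> =
        (\<Sum>k\<le>p. (-1) ^ k * (?A k * b ?B)) + (\<Sum>j\<le>q. (-1) ^ (p + Suc j) * (a ?F * ?C (Suc j)))" .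
    have AF: "?A (Suc p) = a ?F"
      using front_face_face_le[of "Suc p" p "p + q" \<sigma>] front_face_face_gt[of p "Suc p" "p + q" \<sigma>] by simp
    have CB: "?C 0 = b ?B"
      using back_face_face_ge[of 0 q p \<sigma>] back_face_face_le[of p p q \<sigma>] by simp
    have "cup_cochain X (Suc p) q (coboundary p X a) b \<sigma> = (\<Sum>k\<le>Suc p. (-1) ^ k * ?A k) * b ?B"
      unfolding coboundary_def cup_cochain_def using True f1 by simp
    also have "\<dots> = (\<Sum>k\<le>p. (-1) ^ k * (?A k * b ?B)) + (-1) ^ Suc p * (a ?F * b ?B)"
      by (simp only: sum.atMost_Suc AF sum_distrib_right distrib_right mult.assoc)
    finally have 2: "cup_cochain X (Suc p) q (coboundary p X a) b \<sigma>
       = (\<Sum>k\<le>p. (-1) ^ k * (?A k * b ?B)) + (-1) ^ Suc p * (a ?F * b ?B)" .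
    have "cup_cochain X p (Suc q) a (coboundary q X b) \<sigma> = a ?F * (\<Sum>k\<le>Suc q. (-1) ^ k * ?C k)"
      unfolding coboundary_def cup_cochain_def using True f2 by simp
    also have "(\<Sum>k\<le>Suc q. (-1) ^ k * ?C k) = b ?B + (\<Sum>j\<le>q. (-1) ^ Suc j * ?C (Suc j))"
      by (simp only: sum.atMost_Suc_shift CB) simp
    finally have "(-1) ^ p * cup_cochain X p (Suc q) a (coboundary q X b) \<sigma>
        = (-1) ^ p * (a ?F * b ?B) + (\<Sum>j\<le>q. (-1) ^ (p + Suc j) * (a ?F * ?C (Suc j)))"
      by (simp add: distrib_left sum_distrib_left power_add mult.left_commute mult.assoc)
    then show ?thesis using 1 2 by simp
  next
    case False
    then show ?thesis by (simp add: coboundary_def cup_cochain_def)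
  qed
qed

lemma coboundary_diff:
  "coboundary p X (\<lambda>\<sigma>. a \<sigma> - b \<sigma>) = (\<lambda>\<sigma>. coboundary p X a \<sigma> - coboundary p X b \<sigma>)"
  by (simp add: coboundary_def fun_eq_iff right_diff_distrib sum_subtractf)

lemma coboundary_smult:
  "coboundary p X (\<lambda>\<sigma>. r * a \<sigma>) = (\<lambda>\<sigma>. r * coboundary p X a \<sigma>)"
  by (simp add: coboundary_def fun_eq_iff sum_distrib_left mult.left_commute del: sum.atMost_Suc)

lemma coboundary_zero [simp]: "coboundary p X (\<lambda>\<sigma>. 0) = (\<lambda>\<sigma>. 0)"
  by (simp add: coboundary_def fun_eq_iff)

lemma zero_coboundary: "(\<lambda>\<sigma>. 0) \<in> singular_coboundaries p X"
proof (cases p)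
  case (Suc q)
  have "(\<lambda>\<sigma>. 0) \<in> singular_cochains q X" by (simp add: singular_cochains_def)
  then have "coboundary q X (\<lambda>\<sigma>. 0) \<in> coboundary q X ` singular_cochains q X" by (rule imageI)
  then show ?thesis by (simp add: singular_coboundaries_def Suc)
qed (simp add: singular_coboundaries_def)

lemma diff_coboundary:
  assumes "a \<in> singular_coboundaries p X" "b \<in> singular_coboundaries p X"
  shows "(\<lambda>\<sigma>. a \<sigma> - b \<sigma>) \<in> singular_coboundaries p X"
proof (cases p)
  case (Suc q)
  then obtain d e where "d \<in> singular_cochains q X" "e \<in> singular_cochains q X"
      "a = coboundary q X d" "b = coboundary q X e"
    using assms by (auto simp: singular_coboundaries_def)
  moreover from this have "(\<lambda>\<sigma>. d \<sigma> - e \<sigma>) \<in> singular_cochains q X"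
    by (simp add: singular_cochains_def)
  ultimately show ?thesis
    by (auto simp: singular_coboundaries_def Suc coboundary_diff[symmetric])
qed (use assms in \<open>simp add: singular_coboundaries_def\<close>)

lemma equiv_cohomologous: "equiv (singular_cocycles p X) (cohomologous p X)"
proof (rule equivI)
  show "cohomologous p X \<subseteq> singular_cocycles p X \<times> singular_cocycles p X"
    by (auto simp: cohomologous_def)
  show "refl_on (singular_cocycles p X) (cohomologous p X)"
    by (auto simp: refl_on_def cohomologous_def zero_coboundary)
  show "sym (cohomologous p X)"
    using diff_coboundary[OF zero_coboundary] by (fastforce simp: sym_def cohomologous_def)
  show "trans (cohomologous p X)"
  proof (rule transI)
    fix a b c assume ab: "(a, b) \<in> cohomologous p X" and bc: "(b, c) \<in> cohomologous p X"
    have "(\<lambda>\<sigma>. (a \<sigma> - b \<sigma>) - (0 - (b \<sigma> - c \<sigma>))) \<in> singular_coboundaries p X"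
      using ab bc by (intro diff_coboundary[OF _ diff_coboundary[OF zero_coboundary]])
        (auto simp: cohomologous_def)
    then show "(a, c) \<in> cohomologous p X"
      using ab bc by (simp add: cohomologous_def)
  qed
qed

lemma unit_cocycle: "(\<lambda>\<sigma>. if singular_simplex 0 X \<sigma> then 1 else 0) \<in> singular_cocycles 0 X"
  using singular_simplex_singular_face[of "Suc 0" X]
  by (auto simp: singular_cocycles_def singular_cochains_def coboundary_def fun_eq_iff)

lemma cup_cocycle:
  assumes "a \<in> singular_cocycles p X" "b \<in> singular_cocycles q X"
  shows "cup_cochain X p q a b \<in> singular_cocycles (p + q) X"
  using assms by (simp add: singular_cocycles_def singular_cochains_def coboundary_cup)
    (simp add: cup_cochain_def fun_eq_iff)

lemma cup_coboundary_left:
  assumes "c \<in> singular_coboundaries p X" "b \<in> singular_cocycles q X"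
  shows "cup_cochain X p q c b \<in> singular_coboundaries (p + q) X"
proof (cases p)
  case 0
  then have "cup_cochain X p q c b = (\<lambda>\<sigma>. 0)"
    using assms by (simp add: singular_coboundaries_def cup_cochain_def fun_eq_iff)
  then show ?thesis by (simp add: zero_coboundary)
next
  case (Suc p')
  then obtain e where e: "c = coboundary p' X e" using assms by (auto simp: singular_coboundaries_def)
  have "cup_cochain X p q c b = coboundary (p' + q) X (cup_cochain X p' q e b)"
    using assms by (simp add: coboundary_cup e Suc singular_cocycles_def) (simp add: cup_cochain_def fun_eq_iff)
  moreover have "cup_cochain X p' q e b \<in> singular_cochains (p' + q) X"
    by (simp add: singular_cochains_def cup_cochain_def)
  ultimately show ?thesis by (simp add: singular_coboundaries_def Suc)
qed

lemma cup_coboundary_right: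
  fixes a c :: "('a, 'b::{comm_ring, comm_monoid_mult}) cochain"
  assumes "a \<in> singular_cocycles p X" "c \<in> singular_coboundaries q X"
  shows "cup_cochain X p q a c \<in> singular_coboundaries (p + q) X"
proof (cases q)
  case 0
  then have "cup_cochain X p q a c = (\<lambda>\<sigma>. 0)"
    using assms by (simp add: singular_coboundaries_def cup_cochain_def fun_eq_iff)
  then show ?thesis by (simp add: zero_coboundary)
next
  case (Suc q')
  then obtain e where e: "c = coboundary q' X e" using assms by (auto simp: singular_coboundaries_def)
  let ?d = "\<lambda>\<sigma>. (-1) ^ p * cup_cochain X p q' a e \<sigma>"
  have "(-1) ^ p * ((-1) ^ p * r) = r" for r :: 'b
    by (simp add: mult.assoc[symmetric] power_mult_distrib[symmetric])
  note sq = this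
  have "coboundary (p + q') X ?d = cup_cochain X p q a c"
    using assms sq
    by (simp add: coboundary_smult coboundary_cup e Suc singular_cocycles_def)
      (simp add: cup_cochain_def fun_eq_iff)
  moreover have "?d \<in> singular_cochains (p + q') X"
    by (simp add: singular_cochains_def cup_cochain_def)
  ultimately show ?thesis
    by (auto simp: singular_coboundaries_def Suc intro!: image_eqI[of _ _ ?d])
qed

lemma cup_cohomology_class:
  assumes a: "a \<in> singular_cocycles p X" and b: "b \<in> singular_cocycles q X"
  shows "cup X p q (cohomology_class p X a) (cohomology_class q X b)
    = cohomology_class (p + q) X (cup_cochain X p q a b)"
proof -
  have eq: "cohomology_class (p + q) X (cup_cochain X p q a' b')
      = cohomology_class (p + q) X (cup_cochain X p q a b)"
    if a': "(a, a') \<in> cohomologous p X" and b': "(b, b') \<in> cohomologous q X" for a' b'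
  proof -
    have "cup_cochain X p q (\<lambda>\<sigma>. a \<sigma> - a' \<sigma>) b \<in> singular_coboundaries (p + q) X"
      using a' b by (intro cup_coboundary_left) (auto simp: cohomologous_def)
    moreover have "cup_cochain X p q a' (\<lambda>\<sigma>. b \<sigma> - b' \<sigma>) \<in> singular_coboundaries (p + q) X"
      using a' b' by (intro cup_coboundary_right) (auto simp: cohomologous_def)
    ultimately have "(\<lambda>\<sigma>. cup_cochain X p q (\<lambda>\<sigma>. a \<sigma> - a' \<sigma>) b \<sigma>
        - (0 - cup_cochain X p q a' (\<lambda>\<sigma>. b \<sigma> - b' \<sigma>) \<sigma>)) \<in> singular_coboundaries (p + q) X"
      by (intro diff_coboundary zero_coboundary)
    also have "(\<lambda>\<sigma>. cup_cochain X p q (\<lambda>\<sigma>. a \<sigma> - a' \<sigma>) b \<sigma>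
        - (0 - cup_cochain X p q a' (\<lambda>\<sigma>. b \<sigma> - b' \<sigma>) \<sigma>))
        = (\<lambda>\<sigma>. cup_cochain X p q a b \<sigma> - cup_cochain X p q a' b' \<sigma>)"
      by (auto simp: cup_cochain_def fun_eq_iff left_diff_distrib right_diff_distrib)
    finally have "(cup_cochain X p q a b, cup_cochain X p q a' b') \<in> cohomologous (p + q) X"
      using cup_cocycle[OF a b] cup_cocycle[of a' p X b' q] a' b' by (simp add: cohomologous_def)
    then show ?thesis
      unfolding cohomology_class_def by (rule equiv_class_eq[OF equiv_cohomologous, symmetric])
  qed
  have "(a, a) \<in> cohomologous p X" "(b, b) \<in> cohomologous q X"
    using a b by (auto simp: cohomologous_def zero_coboundary)
  then have ne: "a \<in> cohomologous p X `` {a}" "b \<in> cohomologous q X `` {b}" by auto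
  show ?thesis
    unfolding cup_def cohomology_class_def[of p] cohomology_class_def[of q]
  proof (rule equalityI; rule subsetI)
    fix c assume "c \<in> (\<Union>a'\<in>cohomologous p X `` {a}. \<Union>b'\<in>cohomologous q X `` {b}.
        cohomology_class (p + q) X (cup_cochain X p q a' b'))"
    then obtain a' b' where "(a, a') \<in> cohomologous p X" "(b, b') \<in> cohomologous q X"
        "c \<in> cohomology_class (p + q) X (cup_cochain X p q a' b')" by blast
    then show "c \<in> cohomology_class (p + q) X (cup_cochain X p q a b)" using eq by simp
  qed (use ne in blast)
qed

end

theory Submission
  imports Defs
begin

text \<open>
  Let \<open>X\<close> be covered by open sets \<open>U\<^sub>0, ..., U\<^sub>k\<close>, and suppose that every cohomology class of degree between
  \<open>1\<close> and \<open>m\<close> becomes zero on each of them. Then a product of \<open>k + 1\<close> such classes is zero: choose for the \<open>i\<close>-th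
  factor a cocycle that vanishes on all simplices in \<open>U\<^sub>i\<close>. The product of these cocycles vanishes on every
  simplex that lies in one of the sets, and a cocycle of positive degree with this property is a coboundary,
  because iterated subdivision moves every chain into such simplices
  (\<open>cocycle_zero_on_small_simplices_imp_coboundary\<close>).

  It remains to show that a cocycle \<open>c\<close> of degree \<open>p\<close> with \<open>1 \<le> p \<le> m\<close> is a coboundary on an \<open>m\<close>-categorical
  set \<open>U\<close> (\<open>m_categorical_imp_cocycle_coboundary_on\<close>). For coefficients in an arbitrary ring this has to be
  done for all simplices of \<open>U\<close> at once, so one \<open>m\<close>-dimensional complex over \<open>U\<close> must contain all of them
  coherently. In the realization of the singular set of \<open>U\<close> a face of a simplex is identified with a simplex
  of lower dimension by renumbering its vertices. The renumbering is avoided here by giving the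
  vertices labels in \<open>{0, ..., m}\<close>. A cell is then a set \<open>S\<close> of labels together with a map to \<open>U\<close> from the simplex
  with vertex set \<open>S\<close>, and its faces are mere restrictions. A point is given by its barycentric coordinates
  and a map on the smallest face that contains them, and the axioms of a CW complex can be verified with
  explicit functions (\<open>cw_structure_realization\<close>).

  The price is that numbering the vertices of each singular simplex does not give a chain map into this
  complex, as the labels of a face depend on its position. After one barycentric subdivision it does: each
  vertex is labelled by the dimension of the face of which it is the barycentre, which does not change when
  one passes to a larger simplex; the faces that omit a label other than the largest cancel in pairs
  (\<open>chain_face_singular_subdivision\<close>, \<open>chain_boundary_lift_subdivision\<close>). Hence the subdivision operator factors
  as the evaluation map of the complex after a chain map. As \<open>U\<close> is \<open>m\<close>-categorical, the
  evaluation map is nullhomotopic in \<open>X\<close>, and coning off along a nullhomotopy gives an operator \<open>K\<close> that bounds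
  its image (\<open>nullhomotopic_imp_cone_operator\<close>). Together with the chain homotopy \<open>h\<close> from the identity to the
  subdivision, \<open>K\<close> yields the required cochain: it takes the value \<open>c(K(lift(sd \<tau>))) - c(h \<tau>)\<close> on a simplex \<open>\<tau>\<close> of \<open>U\<close>.
\<close>

section \<open>Evaluation of cochains on integral chains\<close>

text \<open>
  The coefficient ring may be the zero ring, whereas \<open>of_int\<close> presupposes \<open>0 \<noteq> 1\<close>. So the integers act here on the
  additive group alone.
\<close>

definition int_smult :: "int \<Rightarrow> 'r::ab_group_add \<Rightarrow> 'r" where
  "int_smult n r = (if 0 \<le> n then \<Sum>i<nat n. r else - (\<Sum>i<nat (- n). r))"

lemma int_smult_add_one: "int_smult (n + 1) r = int_smult n r + r"
proof (cases "0 \<le> n")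
  case True
  then have "nat (n + 1) = Suc (nat n)" by simp
  with True show ?thesis by (simp add: int_smult_def)
next
  case False
  then obtain k where k: "n = - int (Suc k)" by (cases n) auto
  show ?thesis unfolding k by (cases k) (simp_all add: int_smult_def nat_add_distrib)
qed

lemma int_smult_0 [simp]: "int_smult 0 r = 0"
  and int_smult_1 [simp]: "int_smult 1 r = r"
  by (simp_all add: int_smult_def)

lemma int_smult_zero: "int_smult n 0 = 0"
  by (simp add: int_smult_def)

lemma int_smult_add: "int_smult (a + b) r = int_smult a r + int_smult b r"
proof (induction b rule: int_induct[where k = 0])
  case (step1 i)
  then show ?case using int_smult_add_one[of "a + i" r] int_smult_add_one[of i r] by (simp add: algebra_simps)
next
  case (step2 i)
  then show ?case using int_smult_add_one[of "a + (i - 1)" r] int_smult_add_one[of "i - 1" r] by (simp add: algebra_simps)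
qed simp

lemma int_smult_diff: "int_smult (a - b) r = int_smult a r - int_smult b r"
  using int_smult_add[of "a - b" b r] by simp

text \<open>
  Cochains are functions on simplices while chains are integral combinations of them. Extending a cochain
  linearly to chains makes the chain homotopies of singular homology applicable to it.
\<close>

definition pairing :: "('s \<Rightarrow> 'r::ab_group_add) \<Rightarrow> ('s \<Rightarrow>\<^sub>0 int) \<Rightarrow> 'r" where
  "pairing a c = (\<Sum>s\<in>Poly_Mapping.keys c. int_smult (Poly_Mapping.lookup c s) (a s))"

lemma pairing_0 [simp]: "pairing a 0 = 0"
  and pairing_of [simp]: "pairing a (frag_of s) = a s"
  by (simp_all add: pairing_def)

lemma pairing_superset:
  assumes "finite S" "Poly_Mapping.keys c \<subseteq> S"
  shows "pairing a c = (\<Sum>s\<in>S. int_smult (Poly_Mapping.lookup c s) (a s))"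
  unfolding pairing_def using assms by (intro sum.mono_neutral_left) (auto simp: in_keys_iff)

lemma pairing_diff: "pairing a (c - d) = pairing a c - pairing a d"
proof -
  let ?S = "Poly_Mapping.keys c \<union> Poly_Mapping.keys d"
  have "pairing a e = (\<Sum>s\<in>?S. int_smult (Poly_Mapping.lookup e s) (a s))" if "e \<in> {c, d, c - d}" for e
    using that keys_diff[of c d] by (intro pairing_superset) auto
  then show ?thesis by (simp add: lookup_minus int_smult_diff sum_subtractf)
qed

lemma pairing_minus: "pairing a (- c) = - pairing a c"
  using pairing_diff[of a 0 c] by simp

lemma pairing_add: "pairing a (c + d) = pairing a c + pairing a d"
  using pairing_diff[of a c "- d"] by (simp add: pairing_minus)

lemma pairing_sum: "pairing a (\<Sum>i\<in>I. c i) = (\<Sum>i\<in>I. pairing a (c i))"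
  by (induction I rule: infinite_finite_induct) (auto simp: pairing_add)

lemma pairing_sign:
  fixes a :: "'s \<Rightarrow> 'r::{comm_ring, comm_monoid_mult}"
  shows "pairing a (frag_cmul ((-1) ^ k) c) = (-1) ^ k * pairing a c"
proof (induction k)
  case (Suc k)
  have "frag_cmul ((-1) ^ Suc k) c = - frag_cmul ((-1) ^ k) c" by simp
  then show ?case using Suc by (simp only: pairing_minus) simp
qed simp

lemma pairing_eq_0: "(\<And>s. s \<in> Poly_Mapping.keys c \<Longrightarrow> a s = 0) \<Longrightarrow> pairing a c = 0"
  by (simp add: pairing_def int_smult_zero)

lemma coboundary_eq_pairing_boundary:
  fixes a :: "('a, 'r::{comm_ring, comm_monoid_mult}) cochain"
  assumes "singular_simplex (Suc p) X \<sigma>"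
  shows "coboundary p X a \<sigma> = pairing a (chain_boundary (Suc p) (frag_of \<sigma>))"
  using assms by (simp add: coboundary_def chain_boundary_of pairing_sum pairing_sign del: sum.atMost_Suc)

lemma pairing_coboundary:
  fixes a :: "('a, 'r::{comm_ring, comm_monoid_mult}) cochain"
  assumes "singular_chain (Suc p) X c"
  shows "pairing (coboundary p X a) c = pairing a (chain_boundary (Suc p) c)"
  using assms unfolding singular_chain_def
  by (induction c rule: frag_induction)
    (simp_all add: coboundary_eq_pairing_boundary pairing_diff chain_boundary_diff)

lemma pairing_cocycle_boundary:
  fixes a :: "('a, 'r::{comm_ring, comm_monoid_mult}) cochain"
  assumes "a \<in> singular_cocycles p X" "singular_chain (Suc p) X c"
  shows "pairing a (chain_boundary (Suc p) c) = 0"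
  using pairing_coboundary[OF assms(2), of a] assms(1) by (simp add: singular_cocycles_def pairing_eq_0)

section \<open>Cocycles that vanish on small simplices\<close>

text \<open>
  Let \<open>h\<close> be the natural chain homotopy from the identity to the subdivision \<open>sd\<close>. For a cocycle \<open>c\<close> the value on
  \<open>\<sigma>\<close> differs from that on \<open>sd\<^sup>N \<sigma>\<close> by the sum of \<open>c(h(sd\<^sup>i(\<partial>\<sigma>)))\<close> over \<open>i < N\<close>. If \<open>N\<close> is large, then \<open>sd\<^sup>N \<sigma>\<close> is
  small and only the sum remains. The sum is a value of a coboundary: for each face \<open>\<tau>\<close> of \<open>\<sigma>\<close> the terms
  \<open>c(h(sd\<^sup>i \<tau>))\<close> vanish for all large \<open>i\<close>, since \<open>h\<close> does not leave the subspace in which a chain lies. So the number of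
  summands may depend on the simplex.
\<close>

lemma cocycle_zero_on_small_simplices_imp_coboundary:
  fixes c :: "('a, 'r::{comm_ring, comm_monoid_mult}) cochain"
  assumes opn: "\<And>V. V \<in> \<C> \<Longrightarrow> openin X V"
    and cover: "topspace X \<subseteq> \<Union>\<C>"
    and cocycle: "c \<in> singular_cocycles (Suc p) X"
    and small: "\<And>V \<sigma>. V \<in> \<C> \<Longrightarrow> singular_simplex (Suc p) (subtopology X V) \<sigma> \<Longrightarrow> c \<sigma> = 0"
  shows "c \<in> singular_coboundaries (Suc p) X"
proof -
  obtain h :: "nat \<Rightarrow> 'a chain \<Rightarrow> 'a chain" where h0: "\<And>p. h p 0 = 0"
    and hdiff: "\<And>p c1 c2. h p (c1 - c2) = h p c1 - h p c2"
    and hchain: "\<And>p X c. singular_chain p X c \<Longrightarrow> singular_chain (Suc p) X (h p c)"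
    and hbd: "\<And>p X c. singular_chain p X c \<Longrightarrow>
      chain_boundary (Suc p) (h p c) + h (p - Suc 0) (chain_boundary p c) = singular_subdivision p c - c"
    using chain_homotopic_singular_subdivision by blast
  define sd :: "nat \<Rightarrow> nat \<Rightarrow> 'a chain \<Rightarrow> 'a chain" where "sd q i = (singular_subdivision q ^^ i)" for q i
  have sd_chain: "singular_chain q X (sd q i d)" if "singular_chain q X d" for q i d
    using that by (induction i) (auto simp: sd_def singular_chain_singular_subdivision)
  have sd_bd: "chain_boundary (Suc q) (sd (Suc q) i d) = sd q i (chain_boundary (Suc q) d)"
    if "singular_chain (Suc q) X d" for q i d
    using that
  proof (induction i)
    case (Suc i)
    then show ?case
      using sd_chain[of "Suc q" d i] by (simp add: sd_def chain_boundary_singular_subdivision[where X = X])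
  qed (simp add: sd_def)
  have sd_diff: "sd q i (d - e) = sd q i d - sd q i e" for q i d e
    by (simp add: sd_def singular_subdivision_power_diff)
  have smallc: "\<exists>n. \<forall>i\<ge>n. \<forall>f\<in>Poly_Mapping.keys (sd q i (frag_of \<tau>)). \<exists>V\<in>\<C>. singular_simplex q (subtopology X V) f"
    if "singular_simplex q X \<tau>" for q \<tau>
  proof -
    have \<tau>: "singular_chain q X (frag_of \<tau>)" using that by (simp add: singular_chain_of)
    obtain n where n: "\<And>m f. \<lbrakk>n \<le> m; f \<in> Poly_Mapping.keys ((singular_subdivision q ^^ m) (frag_of \<tau>))\<rbrakk>
                      \<Longrightarrow> \<exists>V \<in> \<C>. f \<in> (standard_simplex q) \<rightarrow> V"
      using sufficient_iterated_singular_subdivision_exists[OF opn cover \<tau>] by metis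
    have "\<exists>V\<in>\<C>. singular_simplex q (subtopology X V) f"
      if "n \<le> i" "f \<in> Poly_Mapping.keys (sd q i (frag_of \<tau>))" for i f
      using n[OF that(1), of f] that(2) sd_chain[OF \<tau>, of i]
      by (auto simp: sd_def singular_simplex_subtopology singular_chain_def)
    then show ?thesis by blast
  qed
  then obtain n where n: "\<And>q \<tau> i f. \<lbrakk>singular_simplex q X \<tau>; n q \<tau> \<le> i; f \<in> Poly_Mapping.keys (sd q i (frag_of \<tau>))\<rbrakk>
      \<Longrightarrow> \<exists>V\<in>\<C>. singular_simplex q (subtopology X V) f" by metis
  have ch0: "pairing c (h p d) = 0"
    if "Poly_Mapping.keys d \<subseteq> {f. \<exists>V\<in>\<C>. singular_simplex p (subtopology X V) f}" for d
    using that
  proof (induction d rule: frag_induction)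
    case (one f)
    then obtain V where V: "V \<in> \<C>" "singular_simplex p (subtopology X V) f" by blast
    then have "singular_chain (Suc p) (subtopology X V) (h p (frag_of f))"
      by (intro hchain) (simp add: singular_chain_of)
    then show ?case using small[OF V(1)] by (intro pairing_eq_0) (auto simp: singular_chain_def)
  qed (simp_all add: h0 hdiff pairing_diff)
  \<comment> \<open>The sign occurs because \<open>h\<close> is a homotopy for \<open>sd - id\<close> rather than \<open>id - sd\<close>.\<close>
  define B where "B N d = - (\<Sum>i<N. pairing c (h p (sd p i d)))" for N d
  define b where "b \<tau> = (if singular_simplex p X \<tau> then B (n p \<tau>) (frag_of \<tau>) else 0)" for \<tau>
  have B_stable: "B N (frag_of \<tau>) = b \<tau>" if \<tau>: "singular_simplex p X \<tau>" and N: "n p \<tau> \<le> N" for \<tau> N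
  proof -
    have "(\<Sum>i<N. pairing c (h p (sd p i (frag_of \<tau>)))) = (\<Sum>i<n p \<tau>. pairing c (h p (sd p i (frag_of \<tau>))))"
      using N by (intro sum.mono_neutral_right) (auto intro!: ch0 dest: n[OF \<tau>])
    then show ?thesis by (simp add: B_def b_def \<tau>)
  qed
  have Bb: "B N d = pairing b d" if "Poly_Mapping.keys d \<subseteq> {\<tau>. singular_simplex p X \<tau> \<and> n p \<tau> \<le> N}" for N d
    using that
  proof (induction d rule: frag_induction)
    case (diff d e)
    have "B N (d - e) = B N d - B N e"
      by (simp add: pairing_diff sd_diff hdiff B_def sum_subtractf)
    with diff show ?case by (simp add: pairing_diff)
  next
    case zero
    show ?case by (simp add: B_def h0 sd_def)
  qed (simp add: B_stable)
  have "c = coboundary p X b"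
  proof
    fix \<sigma>
    show "c \<sigma> = coboundary p X b \<sigma>"
    proof (cases "singular_simplex (Suc p) X \<sigma>")
      case True
      let ?d = "chain_boundary (Suc p) (frag_of \<sigma>)"
      have \<sigma>: "singular_chain (Suc p) X (frag_of \<sigma>)" using True by (simp add: singular_chain_of)
      then have d: "singular_chain p X ?d" using singular_chain_boundary by fastforce
      define N where "N = Max (insert (n (Suc p) \<sigma>) (n p ` Poly_Mapping.keys ?d))"
      have N: "n (Suc p) \<sigma> \<le> N" "\<And>\<tau>. \<tau> \<in> Poly_Mapping.keys ?d \<Longrightarrow> n p \<tau> \<le> N"
        unfolding N_def by (intro Max_ge; simp)+
      have step: "pairing c (sd (Suc p) (Suc i) (frag_of \<sigma>)) - pairing c (sd (Suc p) i (frag_of \<sigma>))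
          = pairing c (h p (sd p i ?d))" for i
      proof -
        have "pairing c (singular_subdivision (Suc p) (sd (Suc p) i (frag_of \<sigma>)) - sd (Suc p) i (frag_of \<sigma>))
          = pairing c (h p (sd p i ?d))"
          using pairing_cocycle_boundary[OF cocycle hchain[OF sd_chain[OF \<sigma>]], of i]
          by (simp add: hbd[OF sd_chain[OF \<sigma>], of i, symmetric] pairing_add sd_bd[OF \<sigma>])
        then show ?thesis by (simp add: pairing_diff sd_def)
      qed
      have "pairing c (sd (Suc p) N (frag_of \<sigma>)) - pairing c (sd (Suc p) 0 (frag_of \<sigma>)) = - B N ?d"
        unfolding B_def minus_minus step[symmetric] by (rule sum_lessThan_telescope[symmetric])
      moreover have "pairing c (sd (Suc p) N (frag_of \<sigma>)) = 0"
        using n[OF True N(1)] small by (intro pairing_eq_0) blast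
      ultimately have "c \<sigma> = B N ?d" by (simp add: sd_def)
      also have "\<dots> = pairing b ?d" using N d by (intro Bb) (auto simp: singular_chain_def)
      finally show ?thesis by (simp add: coboundary_eq_pairing_boundary[OF True])
    next
      case False
      then show ?thesis using cocycle by (simp add: singular_cocycles_def singular_cochains_def coboundary_def)
    qed
  qed
  moreover have "b \<in> singular_cochains p X" by (simp add: singular_cochains_def b_def)
  ultimately show ?thesis by (auto simp: singular_coboundaries_def)
qed

section \<open>Faces of a barycentric subdivision\<close>

text \<open>
  One summand of the boundary operator, without its sign, as an operator on chains. The boundary of a subdivision has
  to be known face by face.
\<close>

definition chain_face :: "nat \<Rightarrow> nat \<Rightarrow> 'a chain \<Rightarrow> 'a chain" where
  "chain_face p k = frag_extend (\<lambda>f. frag_of (singular_face p k f))"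

lemma chain_face_0 [simp]: "chain_face p k 0 = 0"
  and chain_face_of [simp]: "chain_face p k (frag_of f) = frag_of (singular_face p k f)"
  and chain_face_diff: "chain_face p k (c - d) = chain_face p k c - chain_face p k d"
  by (simp_all add: chain_face_def frag_extend_diff)

lemma frag_cmul_diff_distrib2: "frag_cmul k (a - b) = frag_cmul k a - frag_cmul k b"
  by (simp add: poly_mapping_eqI lookup_minus right_diff_distrib)

lemma chain_boundary_eq_sum_chain_face:
  "chain_boundary (Suc p) c = (\<Sum>k\<le>Suc p. frag_cmul ((-1) ^ k) (chain_face (Suc p) k c))"
proof -
  have "Poly_Mapping.keys c \<subseteq> UNIV" by simp
  then show ?thesis
    by (induction c rule: frag_induction)
      (simp_all add: chain_boundary_of chain_boundary_diff chain_face_diff sum_subtractf frag_cmul_diff_distrib2 del: sum.atMost_Suc)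
qed

lemma singular_face_Suc_simplex_cone:
  assumes "simplicial_simplex (Suc p) S f" "j \<le> Suc p"
  shows "singular_face (Suc (Suc p)) (Suc j) (simplex_cone (Suc p) v f)
      = simplex_cone p v (singular_face (Suc p) j f)"
  using assms by (auto simp: simplicial_simplex simplex_cone singular_face_oriented_simplex oriented_simplex_eq)

lemma chain_face_Suc_simplicial_cone:
  assumes "simplicial_chain (Suc p) S c" "j \<le> Suc p"
  shows "chain_face (Suc (Suc p)) (Suc j) (simplicial_cone (Suc p) v c)
    = simplicial_cone p v (chain_face (Suc p) j c)"
  using assms(1) unfolding simplicial_chain_def
  by (induction c rule: frag_induction)
    (use assms(2) in \<open>simp_all add: simplicial_cone_def frag_extend_diff chain_face_diff singular_face_Suc_simplex_cone\<close>)

text \<open>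
  The subdivision of a simplex is the cone from its barycentre, put at vertex \<open>0\<close>, over the subdivided boundary.
  A face of the cone that keeps the apex is the cone over a face of the subdivided boundary. If this is not
  face \<open>0\<close>, it vanishes by induction. If it is, then it is the whole boundary of the subdivided boundary,
  because the other faces vanish by induction, and hence zero. In dimension \<open>1\<close> the
  face that keeps the apex is the apex alone, and the two contributions cancel.
\<close>

lemma chain_face_simplicial_subdivision:
  assumes "simplicial_chain p S c" "1 \<le> k" "k \<le> p"
  shows "chain_face p k (simplicial_subdivision p c) = 0"
  using assms
proof (induction p arbitrary: S c k)
  case (Suc p)
  have face0: "chain_face p 0 (simplicial_subdivision p d) = chain_boundary p (simplicial_subdivision p d)"
    if d: "simplicial_chain p S d" and p: "p > 0" for d
  proof -
    obtain q where q: "p = Suc q" using p by (cases p) auto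
    have "chain_face p (Suc k) (simplicial_subdivision p d) = 0" if "k \<le> q" for k
      using Suc.IH[OF d] that q by simp
    then show ?thesis
      unfolding q chain_boundary_eq_sum_chain_face by (simp add: q sum.atMost_Suc_shift del: sum.atMost_Suc)
  qed
  show ?case
    using Suc.prems(1) unfolding simplicial_chain_def
  proof (induction c rule: frag_induction)
    case (one f)
    let ?v = "\<lambda>i. (\<Sum>j\<le>Suc p. simplicial_vertex j f i) / (p + 2)"
    let ?d = "chain_boundary (Suc p) (frag_of f)"
    have f: "simplicial_chain (Suc p) S (frag_of f)" using one by simp
    have d: "simplicial_chain p S ?d" using simplicial_chain_boundary[OF f] by simp
    then have sd: "simplicial_chain p S (simplicial_subdivision p ?d)"
      by (rule simplicial_chain_simplicial_subdivision)
    obtain j where j: "k = Suc j" "j \<le> p" using Suc.prems by (cases k) auto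
    show ?case
    proof (cases p)
      case 0
      obtain l where l: "f = oriented_simplex (Suc 0) l" using one 0 by (auto simp: simplicial_simplex)
      have "simplex_cone 0 v (singular_face (Suc 0) i f) = oriented_simplex (Suc 0) (\<lambda>n. if n = 0 then v else if i = 0 then l 1 else l 0)"
        if "i \<le> 1" for i v
        using that by (auto simp: l singular_face_oriented_simplex simplex_cone oriented_simplex_eq)
      then have "singular_face (Suc 0) (Suc 0) (simplex_cone 0 v (singular_face (Suc 0) i f)) = oriented_simplex 0 (\<lambda>_. v)"
        if "i \<le> 1" for i v
        using that by (auto simp: singular_face_oriented_simplex oriented_simplex_eq)
      then show ?thesis
        using j 0
        by (simp add: chain_boundary_of simplicial_cone_def frag_extend_diff chain_face_diff)
    next
      case (Suc q)
      have "chain_face p j (simplicial_subdivision p ?d) = 0"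
      proof (cases j)
        case 0
        have "chain_boundary p (simplicial_subdivision p ?d) = simplicial_subdivision (p - 1) (chain_boundary p ?d)"
          by (rule chain_boundary_simplicial_subdivision[OF d])
        also have "chain_boundary p ?d = 0"
          using chain_boundary_boundary_alt[of p _ "frag_of f"] simplicial_imp_singular_chain[OF f] by blast
        finally show ?thesis using face0[OF d] 0 Suc by simp
      next
        case (Suc i)
        then show ?thesis using Suc.IH[OF d, of j] j by simp
      qed
      then show ?thesis
        using chain_face_Suc_simplicial_cone[of q S "simplicial_subdivision p ?d" j ?v] sd j Suc
        by (simp add: simplicial_cone_def)
    qed
  qed (simp_all add: frag_extend_diff chain_face_diff)
qed simp

lemma chain_face_chain_map:
  assumes "singular_chain (Suc p) X c" "k \<le> Suc p"
  shows "chain_face (Suc p) k (chain_map (Suc p) g c) = chain_map p g (chain_face (Suc p) k c)"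
  using assms(1) unfolding singular_chain_def
proof (induction c rule: frag_induction)
  case (one f)
  have "singular_face (Suc p) k (simplex_map (Suc p) g f) = simplex_map p g (singular_face (Suc p) k f)"
    using assms(2) simplical_face_in_standard_simplex[of "Suc p" k]
    by (auto simp: singular_face_def simplex_map_def fun_eq_iff)
  then show ?case by simp
qed (simp_all add: chain_map_diff chain_face_diff)

text \<open>
  The first part is carried over from the standard simplex by naturality. So face \<open>0\<close> is the whole boundary, and the
  boundary commutes with subdivision.
\<close>

lemma chain_face_singular_subdivision:
  assumes "singular_chain (Suc p) X c"
  shows "k \<le> p \<Longrightarrow> chain_face (Suc p) (Suc k) (singular_subdivision (Suc p) c) = 0"
    and "chain_face (Suc p) 0 (singular_subdivision (Suc p) c) = singular_subdivision p (chain_boundary (Suc p) c)"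
proof -
  let ?id = "frag_of (restrict id (standard_simplex (Suc p)))"
  have id: "simplicial_chain (Suc p) (standard_simplex (Suc p)) ?id" by simp
  have sing: "singular_chain (Suc p) (subtopology (powertop_real UNIV) (standard_simplex (Suc p)))
       (simplicial_subdivision (Suc p) ?id)"
    by (rule simplicial_imp_singular_chain[OF simplicial_chain_simplicial_subdivision[OF id]])
  have zero: "chain_face (Suc p) (Suc k) (singular_subdivision (Suc p) c) = 0" if "k \<le> p" for k
    using assms unfolding singular_chain_def
  proof (induction c rule: frag_induction)
    case (one f)
    have "chain_face (Suc p) (Suc k) (simplicial_subdivision (Suc p) ?id) = 0"
      using chain_face_simplicial_subdivision[OF id, of "Suc k"] that by (simp only: Suc_le_mono One_nat_def le0 simp_thms)
    then show ?case
      unfolding singular_subdivision_def frag_extend_of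
      using chain_face_chain_map[OF sing, of "Suc k" f] that by simp
  qed (simp_all add: singular_subdivision_diff chain_face_diff)
  then show "k \<le> p \<Longrightarrow> chain_face (Suc p) (Suc k) (singular_subdivision (Suc p) c) = 0" .
  have "chain_boundary (Suc p) (singular_subdivision (Suc p) c) = chain_face (Suc p) 0 (singular_subdivision (Suc p) c)"
    unfolding chain_boundary_eq_sum_chain_face by (simp add: zero sum.atMost_Suc_shift del: sum.atMost_Suc)
  then show "chain_face (Suc p) 0 (singular_subdivision (Suc p) c) = singular_subdivision p (chain_boundary (Suc p) c)"
    using chain_boundary_singular_subdivision[OF assms] by simp
qed

section \<open>The cone operator of a nullhomotopy\<close>

abbreviation simplex_topology :: "nat \<Rightarrow> (nat \<Rightarrow> real) topology" where
  "simplex_topology p \<equiv> subtopology (powertop_real UNIV) (standard_simplex p)"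

text \<open>
  The simplex of dimension \<open>p + 1\<close> obtained by running the homotopy \<open>H\<close> from \<open>\<sigma>\<close>, on the face opposite to vertex \<open>0\<close>, to
  the constant \<open>c\<close> at vertex \<open>0\<close>. The coordinate \<open>x 0\<close> serves as the time.
\<close>

definition cone_simplex :: "nat \<Rightarrow> (real \<times> 'p \<Rightarrow> 'a) \<Rightarrow> 'a \<Rightarrow> 'p simplex \<Rightarrow> 'a simplex" where
  "cone_simplex p H c \<sigma> = (\<lambda>x\<in>standard_simplex (Suc p).
     if x 0 = 1 then c else H (x 0, \<sigma> (\<lambda>i. x (Suc i) / (1 - x 0))))"

text \<open>
  The map from the cylinder to the simplex that collapses the end \<open>t = 1\<close> to vertex \<open>0\<close>.
\<close>

definition join_apex :: "real \<times> (nat \<Rightarrow> real) \<Rightarrow> nat \<Rightarrow> real" where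
  "join_apex = (\<lambda>(t, y) i. case i of 0 \<Rightarrow> t | Suc j \<Rightarrow> (1 - t) * y j)"

lemma join_apex_in_standard_simplex:
  assumes "0 \<le> t" "t \<le> 1" "y \<in> standard_simplex p"
  shows "join_apex (t, y) \<in> standard_simplex (Suc p)"
proof -
  have "0 \<le> join_apex (t, y) i \<and> join_apex (t, y) i \<le> 1" for i
    using assms by (auto simp: join_apex_def standard_simplex_def mult_le_one split: nat.split)
  moreover have "join_apex (t, y) i = 0" if "i > Suc p" for i
    using assms that by (auto simp: join_apex_def standard_simplex_def split: nat.split)
  moreover have "(\<Sum>i\<le>Suc p. join_apex (t, y) i) = t + (1 - t) * (\<Sum>i\<le>p. y i)"
    unfolding sum.atMost_Suc_shift by (simp add: join_apex_def sum_distrib_left)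
  ultimately show ?thesis using assms by (simp add: standard_simplex_def)
qed

lemma opposite_face_in_standard_simplex:
  assumes "x \<in> standard_simplex (Suc p)" "x 0 \<noteq> 1"
  shows "(\<lambda>i. x (Suc i) / (1 - x 0)) \<in> standard_simplex p"
proof -
  have x: "\<And>i. 0 \<le> x i \<and> x i \<le> 1" "\<And>i. i > Suc p \<Longrightarrow> x i = 0" and s: "(\<Sum>i\<le>Suc p. x i) = 1"
    using assms(1) by (auto simp: standard_simplex_def)
  have pos: "1 - x 0 > 0" using x(1)[of 0] assms(2) by auto
  have s': "(\<Sum>i\<le>p. x (Suc i)) = 1 - x 0" using s unfolding sum.atMost_Suc_shift by simp
  have "x (Suc i) \<le> 1 - x 0" for i
  proof (cases "i \<le> p")
    case True
    then have "x (Suc i) \<le> (\<Sum>i\<le>p. x (Suc i))" using x by (intro member_le_sum) auto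
    then show ?thesis using s' by simp
  qed (use x pos in auto)
  then show ?thesis
    using x pos s' by (auto simp: standard_simplex_def field_simps simp flip: sum_divide_distrib)
qed

text \<open>
  This is what makes \<open>cone_simplex\<close> continuous at the apex, where the other coordinates are divided by
  \<open>1 - x 0 = 0\<close>: it is enough to check continuity on the cylinder.
\<close>

lemma quotient_map_join_apex:
  "quotient_map (prod_topology (top_of_set {0..1}) (simplex_topology p)) (simplex_topology (Suc p)) join_apex"
proof -
  let ?D = "prod_topology (top_of_set {0..1::real}) (simplex_topology p)"
  have fst: "continuous_map ?D euclideanreal fst"
    by (rule continuous_map_into_fulltopology[OF continuous_map_fst])
  have snd: "continuous_map ?D (powertop_real UNIV) snd"
    by (rule continuous_map_into_fulltopology[OF continuous_map_snd])
  then have sndi: "continuous_map ?D euclideanreal (\<lambda>z. snd z j)" for j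
    by (simp add: continuous_map_componentwise_UNIV)
  have "continuous_map ?D euclideanreal (\<lambda>z. join_apex z i)" for i
    using fst sndi[of "i - 1"]
    by (cases i) (auto simp: join_apex_def case_prod_unfold intro!: continuous_intros)
  then have "continuous_map ?D (simplex_topology (Suc p)) join_apex"
    by (auto simp: continuous_map_in_subtopology continuous_map_componentwise_UNIV join_apex_in_standard_simplex)
  moreover have "compact_space ?D"
    by (simp add: compact_space_prod_topology compact_space_subtopology compactin_standard_simplex)
  moreover have "Hausdorff_space (simplex_topology (Suc p))"
    by (simp add: Hausdorff_space_subtopology Hausdorff_space_product_topology)
  moreover have "join_apex ` topspace ?D = standard_simplex (Suc p)"
  proof
    show "join_apex ` topspace ?D \<subseteq> standard_simplex (Suc p)"
      by (auto intro: join_apex_in_standard_simplex)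
    show "standard_simplex (Suc p) \<subseteq> join_apex ` topspace ?D"
    proof
      fix x :: "nat \<Rightarrow> real" assume x: "x \<in> standard_simplex (Suc p)"
      show "x \<in> join_apex ` topspace ?D"
      proof (cases "x 0 = 1")
        case True
        obtain y where y: "y \<in> standard_simplex p" using nonempty_standard_simplex by blast
        have "(\<Sum>i\<le>p. x (Suc i)) = 0"
          using x True by (simp add: standard_simplex_def sum.atMost_Suc_shift del: sum.atMost_Suc)
        then have "x (Suc j) = 0" for j
          using x by (cases "j \<le> p") (auto simp: standard_simplex_def sum_nonneg_eq_0_iff)
        then have "x = join_apex (1, y)"
          using True by (auto simp: join_apex_def fun_eq_iff split: nat.split)
        then show ?thesis using y by (intro image_eqI) auto
      next
        case False
        have "x = join_apex (x 0, \<lambda>i. x (Suc i) / (1 - x 0))"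
          using False by (auto simp: join_apex_def fun_eq_iff split: nat.split)
        moreover have "x 0 \<in> {0..1}" using x by (auto simp: standard_simplex_def)
        ultimately show ?thesis
          using opposite_face_in_standard_simplex[OF x False] by (intro image_eqI) auto
      qed
    qed
  qed
  ultimately show ?thesis
    by (intro continuous_closed_imp_quotient_map continuous_imp_closed_map) auto
qed

lemma singular_simplex_cone_simplex:
  assumes H: "continuous_map (prod_topology (top_of_set {0..1}) P) X H"
    and H1: "\<And>y. H (1, y) = c"
    and \<sigma>: "singular_simplex p P \<sigma>"
  shows "singular_simplex (Suc p) X (cone_simplex p H c \<sigma>)"
proof -
  let ?D = "prod_topology (top_of_set {0..1::real}) (simplex_topology p)"
  have "continuous_map ?D (prod_topology (top_of_set {0..1}) P) (\<lambda>(t, y). (t, \<sigma> y))"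
    using \<sigma> by (simp add: continuous_map_prod_top singular_simplex_def)
  then have "continuous_map ?D X (H \<circ> (\<lambda>(t, y). (t, \<sigma> y)))"
    using H by (rule continuous_map_compose)
  then have "continuous_map ?D X (cone_simplex p H c \<sigma> \<circ> join_apex)"
  proof (rule continuous_map_eq)
    fix z assume "z \<in> topspace ?D"
    then obtain t y where z: "z = (t, y)" "0 \<le> t" "t \<le> 1" "y \<in> standard_simplex p" by auto
    then show "(H \<circ> (\<lambda>(t, y). (t, \<sigma> y))) z = (cone_simplex p H c \<sigma> \<circ> join_apex) z"
      using join_apex_in_standard_simplex[of t y p]
      by (auto simp: cone_simplex_def join_apex_def H1)
  qed
  then have "continuous_map (simplex_topology (Suc p)) X (cone_simplex p H c \<sigma>)"
    by (rule continuous_compose_quotient_map[OF quotient_map_join_apex])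
  then show ?thesis by (simp add: singular_simplex_def cone_simplex_def)
qed

lemma singular_face_0_cone_simplex:
  assumes "\<And>y. H (0, y) = \<phi> y"
  shows "singular_face (Suc p) 0 (cone_simplex p H c \<sigma>) = simplex_map p \<phi> \<sigma>"
  using simplical_face_in_standard_simplex[of "Suc p" 0] assms
  by (auto simp: fun_eq_iff singular_face_def simplex_map_def cone_simplex_def simplical_face_def)

lemma singular_face_Suc_cone_simplex:
  assumes "j \<le> Suc p"
  shows "singular_face (Suc (Suc p)) (Suc j) (cone_simplex (Suc p) H c \<sigma>)
     = cone_simplex p H c (singular_face (Suc p) j \<sigma>)"
proof
  fix x :: "nat \<Rightarrow> real"
  have "(\<lambda>i. simplical_face (Suc j) x (Suc i) / (1 - x 0)) = simplical_face j (\<lambda>i. x (Suc i) / (1 - x 0))"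
    by (auto simp: simplical_face_def fun_eq_iff)
  moreover have "simplical_face (Suc j) x 0 = x 0" by (simp add: simplical_face_def)
  ultimately show "singular_face (Suc (Suc p)) (Suc j) (cone_simplex (Suc p) H c \<sigma>) x
     = cone_simplex p H c (singular_face (Suc p) j \<sigma>) x"
    using simplical_face_in_standard_simplex[of "Suc (Suc p)" "Suc j" x] assms
      opposite_face_in_standard_simplex[of x p]
    by (auto simp: singular_face_def cone_simplex_def)
qed

text \<open>
  For a homotopy to a constant map the prism over a simplex may be replaced by a cone, so no subdivision of
  prisms is needed, and the constant map leaves no term in positive degrees.
\<close>

lemma nullhomotopic_imp_cone_operator:
  assumes "nullhomotopic P X \<phi>"
  obtains K where "\<And>p d e. K p (d - e) = K p d - K p e"
    and "\<And>p d. singular_chain p P d \<Longrightarrow> singular_chain (Suc p) X (K p d)"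
    and "\<And>p d. singular_chain (Suc p) P d \<Longrightarrow>
      chain_boundary (Suc (Suc p)) (K (Suc p) d) = chain_map (Suc p) \<phi> d - K p (chain_boundary (Suc p) d)"
proof -
  obtain c H where H: "continuous_map (prod_topology (top_of_set {0..1::real}) P) X H"
    and H0: "\<And>y. H (0, y) = \<phi> y" and H1: "\<And>y. H (1, y) = c"
    using assms by (auto simp: nullhomotopic_def homotopic_with_def)
  define K where "K p = frag_extend (\<lambda>\<sigma>. frag_of (cone_simplex p H c \<sigma>))" for p
  show thesis
  proof (rule that[of K])
    show "K p (d - e) = K p d - K p e" for p d e by (simp add: K_def frag_extend_diff)
    show "singular_chain (Suc p) X (K p d)" if "singular_chain p P d" for p d
      unfolding K_def
    proof (rule singular_chain_extend)
      fix \<sigma> assume "\<sigma> \<in> Poly_Mapping.keys d"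
      then have "singular_simplex p P \<sigma>" using that by (auto simp: singular_chain_def)
      then show "singular_chain (Suc p) X (frag_of (cone_simplex p H c \<sigma>))"
        by (simp add: singular_chain_of singular_simplex_cone_simplex[OF H H1])
    qed
    show "chain_boundary (Suc (Suc p)) (K (Suc p) d) = chain_map (Suc p) \<phi> d - K p (chain_boundary (Suc p) d)"
      if "singular_chain (Suc p) P d" for p d
      using that unfolding singular_chain_def
    proof (induction d rule: frag_induction)
      case (one \<sigma>)
      have "chain_boundary (Suc (Suc p)) (K (Suc p) (frag_of \<sigma>)) =
          frag_of (simplex_map (Suc p) \<phi> \<sigma>)
          + (\<Sum>j\<le>Suc p. frag_cmul ((-1) ^ Suc j) (frag_of (cone_simplex p H c (singular_face (Suc p) j \<sigma>))))"
        by (simp add: K_def chain_boundary_of sum.atMost_Suc_shift[of _ "Suc p"] singular_face_0_cone_simplex[where \<phi> = \<phi>, OF H0]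
          singular_face_Suc_cone_simplex del: sum.atMost_Suc)
      then show ?case
        by (simp add: K_def chain_boundary_of frag_extend_sum frag_extend_cmul sum_negf flip: minus_frag_cmul
          del: sum.atMost_Suc)
    qed (simp_all add: K_def frag_extend_diff chain_map_diff chain_boundary_diff)
  qed
qed

section \<open>Simplices with labelled vertices, and discs\<close>

text \<open>
  The vertices are indexed by a set of labels. The simplex of a subset is then literally a subset
  of the simplex, and the support of a point is the smallest face that contains it.
\<close>

definition vertex_simplex :: "nat set \<Rightarrow> (nat \<Rightarrow> real) set" where
  "vertex_simplex S = {x. (\<forall>i. 0 \<le> x i) \<and> (\<forall>i. i \<notin> S \<longrightarrow> x i = 0) \<and> sum x S = 1}"

abbreviation vertex_simplex_topology :: "nat set \<Rightarrow> (nat \<Rightarrow> real) topology" where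
  "vertex_simplex_topology S \<equiv> subtopology (powertop_real UNIV) (vertex_simplex S)"

abbreviation support :: "(nat \<Rightarrow> real) \<Rightarrow> nat set" where
  "support x \<equiv> {i. x i \<noteq> 0}"

lemma vertex_simplex_le_1:
  assumes "finite S" "x \<in> vertex_simplex S"
  shows "x i \<le> 1"
proof (cases "i \<in> S")
  case True
  then have "x i \<le> sum x S" using assms by (intro member_le_sum) (auto simp: vertex_simplex_def)
  then show ?thesis using assms by (simp add: vertex_simplex_def)
qed (use assms in \<open>auto simp: vertex_simplex_def\<close>)

lemma vertex_simplex_atMost: "vertex_simplex {..p} = standard_simplex p"
proof -
  have "x i \<le> 1" if "x \<in> vertex_simplex {..p}" for x i
    using vertex_simplex_le_1[OF _ that] by simp
  then show ?thesis unfolding vertex_simplex_def standard_simplex_def set_eq_iff mem_Collect_eq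
    by (metis atMost_iff not_le)
qed

lemma support_subset: "x \<in> vertex_simplex S \<Longrightarrow> support x \<subseteq> S"
  by (auto simp: vertex_simplex_def)

lemma vertex_simplex_iff_support:
  assumes "finite S" "x \<in> vertex_simplex S" "finite T"
  shows "x \<in> vertex_simplex T \<longleftrightarrow> support x \<subseteq> T"
proof
  assume T: "support x \<subseteq> T"
  have "sum x T = sum x (support x)" using T assms(3) by (intro sum.mono_neutral_right) auto
  also have "\<dots> = sum x S" using support_subset[OF assms(2)] assms(1) by (intro sum.mono_neutral_left) auto
  finally show "x \<in> vertex_simplex T" using assms T by (auto simp: vertex_simplex_def)
qed (rule support_subset)

lemma vertex_simplex_mono:
  assumes "finite S" "T \<subseteq> S"
  shows "vertex_simplex T \<subseteq> vertex_simplex S"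
proof
  fix x assume x: "x \<in> vertex_simplex T"
  then show "x \<in> vertex_simplex S"
    using vertex_simplex_iff_support[of T x S] support_subset[OF x] assms finite_subset by blast
qed

lemma in_vertex_simplex_support:
  assumes "finite S" "x \<in> vertex_simplex S"
  shows "x \<in> vertex_simplex (support x)"
  using assms vertex_simplex_iff_support[OF assms, of "support x"] finite_subset[OF support_subset[OF assms(2)]]
  by simp

lemma compactin_vertex_simplex:
  assumes "finite S"
  shows "compactin (powertop_real UNIV) (vertex_simplex S)"
proof (rule closed_compactin)
  let ?X = "powertop_real (UNIV :: nat set)"
  show "compactin ?X (UNIV \<rightarrow>\<^sub>E {0..1})" by (simp add: compactin_PiE)
  show "vertex_simplex S \<subseteq> UNIV \<rightarrow>\<^sub>E {0..1}"
  proof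
    fix x assume "x \<in> vertex_simplex S"
    then show "x \<in> UNIV \<rightarrow>\<^sub>E {0..1}"
      using vertex_simplex_le_1[OF assms] by (simp add: vertex_simplex_def PiE_iff)
  qed
  have coord: "continuous_on UNIV (\<lambda>x :: nat \<Rightarrow> real. x i)" for i by simp
  have "closed (\<Inter>i. {x :: nat \<Rightarrow> real. 0 \<le> x i})"
    by (rule closed_INT) (simp add: closed_Collect_le[OF continuous_on_const coord])
  moreover have "closed (\<Inter>i\<in>- S. {x :: nat \<Rightarrow> real. x i = 0})"
    by (rule closed_INT) (simp add: closed_Collect_eq[OF coord continuous_on_const])
  moreover have "continuous_on UNIV (\<lambda>x :: nat \<Rightarrow> real. \<Sum>i\<in>S. x i)"
    by (rule continuous_on_sum) (rule coord)
  then have "closed {x :: nat \<Rightarrow> real. (\<Sum>i\<in>S. x i) = 1}"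
    by (rule closed_Collect_eq[OF _ continuous_on_const])
  ultimately have "closed ((\<Inter>i. {x. 0 \<le> x i}) \<inter> (\<Inter>i\<in>- S. {x. x i = 0}) \<inter> {x :: nat \<Rightarrow> real. (\<Sum>i\<in>S. x i) = 1})"
    by (intro closed_Int)
  also have "(\<Inter>i. {x. 0 \<le> x i}) \<inter> (\<Inter>i\<in>- S. {x. x i = 0}) \<inter> {x. (\<Sum>i\<in>S. x i) = 1} = vertex_simplex S"
    unfolding vertex_simplex_def by blast
  finally show "closedin ?X (vertex_simplex S)" by (simp add: euclidean_product_topology)
qed

lemma compact_space_vertex_simplex: "finite S \<Longrightarrow> compact_space (vertex_simplex_topology S)"
  by (simp add: compact_space_subtopology compactin_vertex_simplex)

text \<open>
  For coordinates \<open>z 0, ..., z n\<close> with sum zero, measured from the barycentre, the simplex consists of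
  the points with value at most \<open>1 / (n + 1)\<close>, with equality on its boundary. So this is the Minkowski functional of the
  simplex up to a factor.
\<close>

definition simplex_gauge :: "nat \<Rightarrow> (nat \<Rightarrow> real) \<Rightarrow> real" where
  "simplex_gauge n z = Max ((\<lambda>j. - z j) ` {..n})"

lemma simplex_gauge_ge: "j \<le> n \<Longrightarrow> - z j \<le> simplex_gauge n z"
  by (simp add: simplex_gauge_def)

lemma simplex_gauge_attained: obtains j where "j \<le> n" "simplex_gauge n z = - z j"
proof -
  have "simplex_gauge n z \<in> (\<lambda>j. - z j) ` {..n}" unfolding simplex_gauge_def by (rule Max_in) auto
  then show thesis using that by auto
qed

lemma simplex_gauge_scale:
  assumes "0 \<le> r" "\<And>j. j \<le> n \<Longrightarrow> z' j = r * z j"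
  shows "simplex_gauge n z' = r * simplex_gauge n z"
proof (rule antisym)
  obtain j where "j \<le> n" "simplex_gauge n z' = - z' j" by (rule simplex_gauge_attained)
  then show "simplex_gauge n z' \<le> r * simplex_gauge n z"
    using assms mult_left_mono[OF simplex_gauge_ge[of j n z] assms(1)] by simp
next
  obtain j where "j \<le> n" "simplex_gauge n z = - z j" by (rule simplex_gauge_attained)
  then show "r * simplex_gauge n z \<le> simplex_gauge n z'" using assms simplex_gauge_ge[of j n z'] by simp
qed

lemma simplex_gauge_nonneg:
  assumes "(\<Sum>j\<le>n. z j) = 0"
  shows "0 \<le> simplex_gauge n z"
proof (rule ccontr)
  assume "\<not> 0 \<le> simplex_gauge n z"
  then have "0 < z j" if "j \<le> n" for j using simplex_gauge_ge[OF that, of z] by simp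
  then have "0 < (\<Sum>j\<le>n. z j)" by (intro sum_pos) auto
  then show False using assms by simp
qed

lemma simplex_gauge_eq_0D:
  assumes "(\<Sum>j\<le>n. z j) = 0" "simplex_gauge n z = 0" "j \<le> n"
  shows "z j = 0"
proof -
  have "0 \<le> z j" if "j \<le> n" for j using simplex_gauge_ge[OF that, of z] assms(2) by simp
  then show ?thesis using assms sum_nonneg_eq_0_iff[of "{..n}" z] by simp
qed

lemma continuous_on_simplex_gauge:
  fixes F :: "'b::topological_space \<Rightarrow> nat \<Rightarrow> real"
  assumes "\<And>j. continuous_on A (\<lambda>x. F x j)"
  shows "continuous_on A (\<lambda>x. simplex_gauge n (F x))"
proof (induction n)
  case 0
  have "simplex_gauge 0 z = - z 0" for z by (simp add: simplex_gauge_def)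
  then show ?case using assms by (simp add: continuous_intros)
next
  case (Suc n)
  have "simplex_gauge (Suc n) z = max (- z (Suc n)) (simplex_gauge n z)" for z
    by (simp add: simplex_gauge_def atMost_Suc)
  then show ?case using assms Suc by (simp add: continuous_intros)
qed

definition euclidean_length :: "nat \<Rightarrow> (nat \<Rightarrow> real) \<Rightarrow> real" where
  "euclidean_length n z = sqrt (\<Sum>j<n. (z j)\<^sup>2)"

lemma euclidean_length_nonneg: "0 \<le> euclidean_length n z"
  by (simp add: euclidean_length_def sum_nonneg)

lemma abs_le_euclidean_length: "j < n \<Longrightarrow> \<bar>z j\<bar> \<le> euclidean_length n z"
  unfolding euclidean_length_def
  by (rule real_le_rsqrt) (auto intro: member_le_sum)

lemma euclidean_length_scale:
  assumes "\<And>j. j < n \<Longrightarrow> z' j = r * z j" "0 \<le> r"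
  shows "euclidean_length n z' = r * euclidean_length n z"
  using assms by (simp add: euclidean_length_def power_mult_distrib real_sqrt_mult flip: sum_distrib_left)

lemma euclidean_length_eq_0D: "euclidean_length n z = 0 \<Longrightarrow> j < n \<Longrightarrow> z j = 0"
  using abs_le_euclidean_length[of j n z] by simp

lemma in_disc_iff: "w \<in> topspace (disc n) \<longleftrightarrow> (\<forall>i\<ge>n. w i = 0) \<and> euclidean_length n w \<le> 1"
  by (auto simp: disc_def topspace_Euclidean_space euclidean_length_def)

lemma in_open_disc_iff: "w \<in> open_disc n \<longleftrightarrow> (\<forall>i\<ge>n. w i = 0) \<and> euclidean_length n w < 1"
  by (auto simp: open_disc_def in_disc_iff) (simp_all add: euclidean_length_def)

lemma in_disc_boundary_iff: "w \<in> disc_boundary n \<longleftrightarrow> w \<in> topspace (disc n) \<and> w \<notin> open_disc n"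
  by (auto simp: open_disc_def disc_boundary_def disc_def)

definition centred :: "nat \<Rightarrow> (nat \<Rightarrow> nat) \<Rightarrow> (nat \<Rightarrow> real) \<Rightarrow> nat \<Rightarrow> real" where
  "centred n h x j = x (h j) - 1 / real (Suc n)"

text \<open>
  Each ray from the barycentre is rescaled, by the ratio of the gauge of the simplex to the Euclidean length.
  The last of the \<open>n + 1\<close> coordinates is dropped, since it is determined by the others. At the barycentre the
  quotient is \<open>0 / 0 = 0\<close>, which gives the correct value.
\<close>

definition simplex_to_disc :: "nat \<Rightarrow> (nat \<Rightarrow> nat) \<Rightarrow> (nat \<Rightarrow> real) \<Rightarrow> nat \<Rightarrow> real" where
  "simplex_to_disc n h x = (\<lambda>j. if j < n
     then centred n h x j * (real (Suc n) * simplex_gauge n (centred n h x) / euclidean_length n (centred n h x)) else 0)"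

context
  fixes n :: nat and h :: "nat \<Rightarrow> nat" and S :: "nat set"
  assumes h: "bij_betw h {..n} S"
begin

lemma sum_over_vertices: "sum x S = (\<Sum>j\<le>n. x (h j))" for x :: "nat \<Rightarrow> real"
  using sum.reindex_bij_betw[OF h, of x] by simp

lemma sum_centred: "x \<in> vertex_simplex S \<Longrightarrow> (\<Sum>j\<le>n. centred n h x j) = 0"
  by (simp add: centred_def sum_subtractf vertex_simplex_def sum_over_vertices)

lemma vertex_simplex_eqI:
  assumes "x \<in> vertex_simplex S" "y \<in> vertex_simplex S" "\<And>j. j \<le> n \<Longrightarrow> centred n h x j = centred n h y j"
  shows "x = y"
proof
  fix i
  show "x i = y i"
  proof (cases "i \<in> S")
    case True
    then obtain j where "j \<le> n" "i = h j" using h by (auto simp: bij_betw_def)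
    then show ?thesis using assms(3)[of j] by (simp add: centred_def)
  qed (use assms in \<open>auto simp: vertex_simplex_def\<close>)
qed

lemma last_centred: 
  assumes "x \<in> vertex_simplex S"
  shows "centred n h x n = - (\<Sum>j<n. centred n h x j)"
proof -
  have "{..n} = insert n {..<n}" by auto
  then show ?thesis using sum_centred[OF assms] by simp
qed

lemma simplex_gauge_eq_0_iff_length_eq_0:
  assumes "x \<in> vertex_simplex S"
  shows "simplex_gauge n (centred n h x) = 0 \<longleftrightarrow> euclidean_length n (centred n h x) = 0"
proof
  assume "simplex_gauge n (centred n h x) = 0"
  then show "euclidean_length n (centred n h x) = 0"
    using simplex_gauge_eq_0D[OF sum_centred[OF assms]] by (simp add: euclidean_length_def)
next
  assume "euclidean_length n (centred n h x) = 0"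
  then have 1: "centred n h x j = 0" if "j < n" for j using euclidean_length_eq_0D that by blast
  then have "centred n h x n = 0" using last_centred[OF assms] by simp
  with 1 have "centred n h x j = 0" if "j \<le> n" for j using that by (cases "j = n") auto
  then show "simplex_gauge n (centred n h x) = 0" using simplex_gauge_attained[of n "centred n h x"] by force
qed

lemma scaled_simplex_gauge_bounds:
  assumes "x \<in> vertex_simplex S"
  shows "real (Suc n) * simplex_gauge n (centred n h x) \<le> 1"
    and "real (Suc n) * simplex_gauge n (centred n h x) < 1 \<longleftrightarrow> support x = S"
proof -
  have eq: "real (Suc n) * (- centred n h x j) = 1 - real (Suc n) * x (h j)" for j
    by (simp add: centred_def right_diff_distrib)
  have x0: "0 \<le> x i" for i using assms by (simp add: vertex_simplex_def)
  obtain j where j: "j \<le> n" "simplex_gauge n (centred n h x) = - centred n h x j" by (rule simplex_gauge_attained)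
  show "real (Suc n) * simplex_gauge n (centred n h x) \<le> 1"
    unfolding j eq using x0 by simp
  show "real (Suc n) * simplex_gauge n (centred n h x) < 1 \<longleftrightarrow> support x = S"
  proof
    assume L: "real (Suc n) * simplex_gauge n (centred n h x) < 1"
    have "x i \<noteq> 0" if i: "i \<in> S" for i
    proof -
      obtain k where k: "k \<le> n" "i = h k" using h i by (auto simp: bij_betw_def)
      have "real (Suc n) * (- centred n h x k) \<le> real (Suc n) * simplex_gauge n (centred n h x)"
        using simplex_gauge_ge[OF k(1)] by (intro mult_left_mono) auto
      then show ?thesis using L unfolding eq k(2) by auto
    qed
    then show "support x = S" using support_subset[OF assms] by auto
  next
    assume "support x = S"
    then have "x (h j) > 0" using j(1) h x0[of "h j"] by (auto simp: bij_betw_def less_le)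
    then show "real (Suc n) * simplex_gauge n (centred n h x) < 1" unfolding j eq by simp
  qed
qed

lemma length_simplex_to_disc:
  assumes "x \<in> vertex_simplex S"
  shows "euclidean_length n (simplex_to_disc n h x) = real (Suc n) * simplex_gauge n (centred n h x)"
proof -
  let ?l = "euclidean_length n (centred n h x)" and ?g = "real (Suc n) * simplex_gauge n (centred n h x)"
  have g: "0 \<le> ?g" using simplex_gauge_nonneg[OF sum_centred[OF assms]] by simp
  have "euclidean_length n (simplex_to_disc n h x) = ?g / ?l * ?l"
    using g euclidean_length_nonneg[of n "centred n h x"]
    by (intro euclidean_length_scale) (auto simp: simplex_to_disc_def mult.commute)
  also have "\<dots> = ?g" using simplex_gauge_eq_0_iff_length_eq_0[OF assms] by (cases "?l = 0") auto
  finally show ?thesis .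
qed

text \<open>
  At the barycentre each coordinate is bounded by the gauge, which tends to zero.
\<close>

lemma continuous_on_simplex_to_disc: "continuous_on (vertex_simplex S) (simplex_to_disc n h)"
proof (rule continuous_on_coordinatewise_then_product)
  fix j
  let ?V = "vertex_simplex S"
  let ?z = "centred n h" and ?g = "\<lambda>x. real (Suc n) * simplex_gauge n (centred n h x)" and ?l = "\<lambda>x. euclidean_length n (centred n h x)"
  have z: "continuous_on ?V (\<lambda>x. ?z x j)" for j
    unfolding centred_def by (intro continuous_intros continuous_on_product_coordinates[THEN continuous_on_subset]) auto
  then have g: "continuous_on ?V ?g" by (intro continuous_intros continuous_on_simplex_gauge)
  have l: "continuous_on ?V ?l" unfolding euclidean_length_def by (intro continuous_intros z)
  show "continuous_on ?V (\<lambda>x. simplex_to_disc n h x j)"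
  proof (cases "j < n")
    case True
    have "((\<lambda>x. ?z x j * (?g x / ?l x)) \<longlongrightarrow> ?z x j * (?g x / ?l x)) (at x within ?V)" if x: "x \<in> ?V" for x
    proof (cases "?l x = 0")
      case False
      then show ?thesis
        using z[of j] g l x unfolding continuous_on_def
        by (intro tendsto_mult[where g = "\<lambda>x. ?g x / ?l x"] tendsto_divide[where f = ?g and g = ?l]) blast+
    next
      case True
      then have gx: "?g x = 0" using simplex_gauge_eq_0_iff_length_eq_0[OF x] by simp
      have "(?g \<longlongrightarrow> ?g x) (at x within ?V)" using g x unfolding continuous_on_def by blast
      then have lim: "(?g \<longlongrightarrow> 0) (at x within ?V)" by (simp only: gx)
      have "eventually (\<lambda>y. norm (?z y j * (?g y / ?l y)) \<le> ?g y) (at x within ?V)"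
        unfolding eventually_at_topological
      proof (intro exI[of _ UNIV] conjI impI ballI)
        fix y assume y: "y \<in> ?V"
        have g: "0 \<le> ?g y" using simplex_gauge_nonneg[OF sum_centred[OF y]] by simp
        have "\<bar>?z y j\<bar> \<le> ?l y" using \<open>j < n\<close> by (rule abs_le_euclidean_length)
        then have "\<bar>?z y j\<bar> / ?l y \<le> 1"
          using euclidean_length_nonneg[of n "?z y"] by (auto simp: divide_le_eq_1)
        then have "\<bar>?z y j\<bar> / ?l y * ?g y \<le> 1 * ?g y" using g by (rule mult_right_mono)
        moreover have "norm (?z y j * (?g y / ?l y)) = \<bar>?z y j\<bar> / ?l y * ?g y"
          by (simp only: real_norm_def abs_mult[of "?z y j"] abs_divide abs_of_nonneg[OF g]
            abs_of_nonneg[OF euclidean_length_nonneg] times_divide_eq_right times_divide_eq_left)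
        ultimately show "norm (?z y j * (?g y / ?l y)) \<le> ?g y" by (simp only: mult_1_left)
      qed auto
      then have "((\<lambda>x. ?z x j * (?g x / ?l x)) \<longlongrightarrow> 0) (at x within ?V)"
        using lim by (rule Lim_null_comparison)
      then show ?thesis by (simp only: True div_by_0 mult_zero_right)
    qed
    then show ?thesis using True by (simp add: continuous_on_def simplex_to_disc_def)
  qed (simp add: simplex_to_disc_def)
qed

text \<open>
  Two points with the same image lie on one ray and have the same gauge.
\<close>

lemma inj_on_simplex_to_disc: "inj_on (simplex_to_disc n h) (vertex_simplex S)"
proof (rule inj_onI)
  fix x y assume x: "x \<in> vertex_simplex S" and y: "y \<in> vertex_simplex S"
    and eq: "simplex_to_disc n h x = simplex_to_disc n h y"
  let ?z = "centred n h" and ?g = "\<lambda>x. simplex_gauge n (centred n h x)" and ?l = "\<lambda>x. euclidean_length n (centred n h x)"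
  have g: "?g x = ?g y"
    using arg_cong[OF eq, of "euclidean_length n"] by (simp add: length_simplex_to_disc x y)
  show "x = y"
  proof (cases "?g x = 0")
    case True
    then have "?z x j = 0" "?z y j = 0" if "j \<le> n" for j
      using simplex_gauge_eq_0D[OF sum_centred[OF x] _ that] simplex_gauge_eq_0D[OF sum_centred[OF y] _ that] g by simp_all
    then show ?thesis by (intro vertex_simplex_eqI x y) simp
  next
    case False
    then have l: "?l x > 0" "?l y > 0"
      using g simplex_gauge_eq_0_iff_length_eq_0[OF x] simplex_gauge_eq_0_iff_length_eq_0[OF y]
        euclidean_length_nonneg[of n "?z x"] euclidean_length_nonneg[of n "?z y"] by simp_all
    have lt: "?z y j = ?l y / ?l x * ?z x j" if "j < n" for j
    proof -
      have "?z x j * (real (Suc n) * ?g x / ?l x) = ?z y j * (real (Suc n) * ?g x / ?l y)"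
        using fun_cong[OF eq, of j] that g by (simp add: simplex_to_disc_def del: of_nat_Suc)
      moreover have "p / l = q / l'" if "p * (a / l) = q * (a / l')" "a \<noteq> 0" for p q a l l' :: real
      proof -
        have "p / l * a = q / l' * a" using that(1) by (simp only: times_divide_eq_right times_divide_eq_left)
        then show ?thesis using that(2) mult_right_cancel by blast
      qed
      moreover have "real (Suc n) * ?g x \<noteq> 0" using False by simp
      ultimately have "?z x j / ?l x = ?z y j / ?l y" by blast
      then show ?thesis using l by (simp add: field_simps)
    qed
    moreover have "?z y n = ?l y / ?l x * ?z x n"
    proof -
      have "(\<Sum>j<n. ?z y j) = (\<Sum>j<n. ?l y / ?l x * ?z x j)" by (intro sum.cong lt) auto
      then show ?thesis unfolding last_centred[OF x] last_centred[OF y] by (simp only: sum_distrib_left mult_minus_right)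
    qed
    ultimately have le: "?z y j = ?l y / ?l x * ?z x j" if "j \<le> n" for j
      using that by (cases "j = n") auto
    then have "?g y = ?l y / ?l x * ?g x" using l by (intro simplex_gauge_scale) auto
    then have "?l y / ?l x * ?g x = 1 * ?g x" using g by (simp only: mult_1_left)
    then have "?l y / ?l x = 1" using False mult_right_cancel by blast
    then show ?thesis using le by (intro vertex_simplex_eqI x y) simp
  qed
qed

lemma simplex_to_disc_onto:
  assumes w: "w \<in> topspace (disc n)"
  shows "w \<in> simplex_to_disc n h ` vertex_simplex S"
proof -
  have w0: "\<And>i. i \<ge> n \<Longrightarrow> w i = 0" and len: "euclidean_length n w \<le> 1" using w by (auto simp: in_disc_iff)
  define W where "W j = (if j < n then w j else - (\<Sum>i<n. w i))" for j
  have "{..n} = insert n {..<n}" by auto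
  then have W: "(\<Sum>j\<le>n. W j) = 0" by (simp add: W_def)
  let ?l = "euclidean_length n w" and ?G = "real (Suc n) * simplex_gauge n W"
  have G: "0 \<le> ?G" using simplex_gauge_nonneg[OF W] by simp
  \<comment> \<open>The point with centred coordinates \<open>t W\<close> is sent to \<open>w\<close>. For \<open>w = 0\<close> the convention \<open>0 / 0 = 0\<close>
    gives \<open>t = 0\<close>, that is, the barycentre.\<close>
  define t where "t = ?l / ?G"
  have t: "0 \<le> t" using G euclidean_length_nonneg[of n w] by (simp add: t_def)
  have G0: "?l = 0" if "?G = 0"
  proof -
    have "w j = 0" if "j < n" for j 
    proof -
      have "W j = 0" using simplex_gauge_eq_0D[OF W, of j] that \<open>?G = 0\<close> by simp
      then show ?thesis using that by (simp add: W_def)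
    qed
    then show ?thesis by (simp add: euclidean_length_def)
  qed
  have tG: "t * ?G = ?l" using G0 by (auto simp: t_def)
  define x where "x i = (if i \<in> S then 1 / real (Suc n) + t * W (inv_into {..n} h i) else 0)" for i
  have inv: "inv_into {..n} h (h j) = j" if "j \<le> n" for j
    using h that by (auto simp: bij_betw_def inv_into_f_f)
  have xh: "x (h j) = 1 / real (Suc n) + t * W j" if "j \<le> n" for j
    using that h inv by (auto simp: x_def bij_betw_def)
  then have z: "centred n h x j = t * W j" if "j \<le> n" for j using that by (simp add: centred_def)
  have "0 \<le> x i" for i
  proof (cases "i \<in> S")
    case True
    then obtain j where j: "j \<le> n" "i = h j" using h by (auto simp: bij_betw_def)
    have "t * (- W j) \<le> t * simplex_gauge n W" using t simplex_gauge_ge[OF j(1)] by (intro mult_left_mono) auto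
    also have "\<dots> = ?l / real (Suc n)" using tG by (simp add: field_simps)
    also have "\<dots> \<le> 1 / real (Suc n)" using len by (intro divide_right_mono) auto
    finally show ?thesis using xh[OF j(1)] j(2) by simp
  qed (simp add: x_def)
  moreover have "sum x S = 1"
    using W by (simp add: sum_over_vertices xh sum.distrib flip: sum_distrib_left)
  ultimately have x: "x \<in> vertex_simplex S" by (auto simp: vertex_simplex_def x_def)
  have g: "real (Suc n) * simplex_gauge n (centred n h x) = ?l"
    using simplex_gauge_scale[of t n "centred n h x" W] t z tG by (simp add: field_simps)
  have l: "euclidean_length n (centred n h x) = t * ?l"
    using t z by (intro euclidean_length_scale) (auto simp: W_def)
  have "simplex_to_disc n h x = w"
  proof
    fix j
    show "simplex_to_disc n h x j = w j"
    proof (cases "j < n")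
      case True
      have "simplex_to_disc n h x j = t * W j * (?l / (t * ?l))"
        unfolding simplex_to_disc_def g l using True z[of j] by simp
      also have "\<dots> = w j"
      proof (cases "?l = 0")
        case True
        then show ?thesis using euclidean_length_eq_0D[of n w j] \<open>j < n\<close> by simp
      next
        case False
        then have "t \<noteq> 0" using tG by auto
        then show ?thesis using False \<open>j < n\<close> by (simp add: W_def)
      qed
      finally show ?thesis .
    qed (use w0 in \<open>simp add: simplex_to_disc_def\<close>)
  qed
  then show ?thesis using x by blast
qed

lemma homeomorphic_map_simplex_to_disc:
  "homeomorphic_map (vertex_simplex_topology S) (disc n) (simplex_to_disc n h)"
proof (rule continuous_imp_homeomorphic_map)
  have S: "finite S" using h bij_betw_finite by blast
  show "compact_space (vertex_simplex_topology S)" by (rule compact_space_vertex_simplex[OF S])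
  show "Hausdorff_space (disc n)"
    by (simp add: disc_def Euclidean_space_def Hausdorff_space_subtopology Hausdorff_space_product_topology)
  have "simplex_to_disc n h x \<in> topspace (disc n)" if "x \<in> vertex_simplex S" for x
    using that scaled_simplex_gauge_bounds(1)[OF that] by (auto simp: in_disc_iff length_simplex_to_disc) (simp add: simplex_to_disc_def)
  then show im: "simplex_to_disc n h ` topspace (vertex_simplex_topology S) = topspace (disc n)"
    using simplex_to_disc_onto by auto
  show "inj_on (simplex_to_disc n h) (topspace (vertex_simplex_topology S))"
    using inj_on_simplex_to_disc by simp
  have "continuous_map (vertex_simplex_topology S) (powertop_real UNIV) (simplex_to_disc n h)"
    using continuous_on_simplex_to_disc by (simp add: euclidean_product_topology)
  then show "continuous_map (vertex_simplex_topology S) (disc n) (simplex_to_disc n h)"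
    using im unfolding disc_def Euclidean_space_def
    by (auto simp: continuous_map_in_subtopology)
qed

lemma simplex_to_disc_in_open_disc:
  "x \<in> vertex_simplex S \<Longrightarrow> simplex_to_disc n h x \<in> open_disc n \<longleftrightarrow> support x = S"
  using scaled_simplex_gauge_bounds(2)[of x] by (simp add: in_open_disc_iff length_simplex_to_disc) (simp add: simplex_to_disc_def)

end

lemma disc_homeomorphic_vertex_simplex:
  assumes "finite S" "card S = Suc n"
  shows "\<exists>r. homeomorphic_map (disc n) (vertex_simplex_topology S) r \<and>
    (\<forall>w\<in>topspace (disc n). w \<in> open_disc n \<longleftrightarrow> support (r w) = S)"
proof -
  obtain h where h: "bij_betw h {..n} S"
    using assms bij_betw_iff_card[of "{..n}" S] by auto
  obtain r where r: "homeomorphic_maps (vertex_simplex_topology S) (disc n) (simplex_to_disc n h) r"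
    using homeomorphic_map_simplex_to_disc[OF h] by (auto simp: homeomorphic_map_maps)
  have "w \<in> open_disc n \<longleftrightarrow> support (r w) = S" if "w \<in> topspace (disc n)" for w
  proof -
    have "r w \<in> vertex_simplex S" "simplex_to_disc n h (r w) = w"
      using r that by (auto simp: homeomorphic_maps_def continuous_map_def Pi_iff)
    then show ?thesis using simplex_to_disc_in_open_disc[OF h, of "r w"] by simp
  qed
  then show ?thesis using r by (meson homeomorphic_maps_sym homeomorphic_maps_imp_map)
qed

section \<open>The realization of the labelled simplices of a space\<close>

lemma vertex_simplex_empty: "vertex_simplex {} = {}"
  by (simp add: vertex_simplex_def)

text \<open>
  Maps are normalised outside the simplex, as for singular simplices, so that a face is a restriction.
\<close>

definition labelled_simplex :: "nat set \<Rightarrow> 'a topology \<Rightarrow> 'a simplex \<Rightarrow> bool" where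
  "labelled_simplex S Y \<sigma> \<longleftrightarrow>
     continuous_map (vertex_simplex_topology S) Y \<sigma> \<and> \<sigma> \<in> extensional (vertex_simplex S)"

text \<open>
  The point with barycentric coordinates \<open>x\<close> in the simplex \<open>\<sigma>\<close>. Only the restriction of \<open>\<sigma>\<close> to the smallest face around
  \<open>x\<close> is recorded, and this glues simplices along common faces. The first component is a dummy.
\<close>

definition realization_point :: "'a simplex \<Rightarrow> (nat \<Rightarrow> real) \<Rightarrow> 'a cw_point" where
  "realization_point \<sigma> x = (0, restrict \<sigma> (vertex_simplex (support x)), x)"

definition realization_points :: "nat \<Rightarrow> 'a topology \<Rightarrow> 'a cw_point set" where
  "realization_points m Y =
     {realization_point \<sigma> x | S \<sigma> x. S \<subseteq> {..m} \<and> labelled_simplex S Y \<sigma> \<and> x \<in> vertex_simplex S}"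

text \<open>
  The weak topology with respect to all labelled simplices.
\<close>

definition realization :: "nat \<Rightarrow> 'a topology \<Rightarrow> 'a cw_point topology" where
  "realization m Y = topology (\<lambda>W. W \<subseteq> realization_points m Y \<and>
     (\<forall>S \<sigma>. S \<subseteq> {..m} \<and> labelled_simplex S Y \<sigma> \<longrightarrow>
        openin (vertex_simplex_topology S) {x \<in> vertex_simplex S. realization_point \<sigma> x \<in> W}))"

lemma openin_realization:
  "openin (realization m Y) W \<longleftrightarrow> W \<subseteq> realization_points m Y \<and>
     (\<forall>S \<sigma>. S \<subseteq> {..m} \<and> labelled_simplex S Y \<sigma> \<longrightarrow>
        openin (vertex_simplex_topology S) {x \<in> vertex_simplex S. realization_point \<sigma> x \<in> W})"
proof -
  have "istopology (\<lambda>W. W \<subseteq> realization_points m Y \<and>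
     (\<forall>S \<sigma>. S \<subseteq> {..m} \<and> labelled_simplex S Y \<sigma> \<longrightarrow>
        openin (vertex_simplex_topology S) {x \<in> vertex_simplex S. realization_point \<sigma> x \<in> W}))"
    (is "istopology ?o")
    unfolding istopology_def
  proof (intro conjI allI impI)
    fix V W assume V: "?o V" and W: "?o W"
    have "{x \<in> vertex_simplex S. realization_point \<sigma> x \<in> V \<inter> W} =
      {x \<in> vertex_simplex S. realization_point \<sigma> x \<in> V} \<inter> {x \<in> vertex_simplex S. realization_point \<sigma> x \<in> W}" for S \<sigma>
      by blast
    then show "openin (vertex_simplex_topology S) {x \<in> vertex_simplex S. realization_point \<sigma> x \<in> V \<inter> W}"
      if "S \<subseteq> {..m} \<and> labelled_simplex S Y \<sigma>" for S \<sigma>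
      using V W that by (simp only: openin_Int)
    show "V \<inter> W \<subseteq> realization_points m Y" using V by blast
  next
    fix \<W> assume \<W>: "\<forall>W\<in>\<W>. ?o W"
    have "{x \<in> vertex_simplex S. realization_point \<sigma> x \<in> \<Union>\<W>} =
      (\<Union>W\<in>\<W>. {x \<in> vertex_simplex S. realization_point \<sigma> x \<in> W})" for S \<sigma>
      by blast
    then show "openin (vertex_simplex_topology S) {x \<in> vertex_simplex S. realization_point \<sigma> x \<in> \<Union>\<W>}"
      if "S \<subseteq> {..m} \<and> labelled_simplex S Y \<sigma>" for S \<sigma>
      using \<W> that by (simp only:) (intro openin_Union, blast)
    show "\<Union>\<W> \<subseteq> realization_points m Y" using \<W> by blast
  qed
  then show ?thesis by (simp add: realization_def)
qed

lemma realization_point_in: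
  assumes "S \<subseteq> {..m}" "labelled_simplex S Y \<sigma>" "x \<in> vertex_simplex S"
  shows "realization_point \<sigma> x \<in> realization_points m Y"
  using assms by (auto simp: realization_points_def)

lemma topspace_realization [simp]: "topspace (realization m Y) = realization_points m Y"
proof
  show "topspace (realization m Y) \<subseteq> realization_points m Y"
    using openin_topspace[of "realization m Y"] unfolding openin_realization by (rule conjunct1)
  have "{x \<in> vertex_simplex S. realization_point \<sigma> x \<in> realization_points m Y} = topspace (vertex_simplex_topology S)"
    if "S \<subseteq> {..m} \<and> labelled_simplex S Y \<sigma>" for S \<sigma>
    using realization_point_in[of S m Y \<sigma>] that by auto
  then have "openin (vertex_simplex_topology S) {x \<in> vertex_simplex S. realization_point \<sigma> x \<in> realization_points m Y}"
    if "S \<subseteq> {..m} \<and> labelled_simplex S Y \<sigma>" for S \<sigma>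
    using that by (simp only: openin_topspace)
  then have "openin (realization m Y) (realization_points m Y)"
    unfolding openin_realization by blast
  then show "realization_points m Y \<subseteq> topspace (realization m Y)" by (rule openin_subset)
qed

lemma closedin_realization:
  assumes "A \<subseteq> realization_points m Y"
  shows "closedin (realization m Y) A \<longleftrightarrow> (\<forall>S \<sigma>. S \<subseteq> {..m} \<and> labelled_simplex S Y \<sigma> \<longrightarrow>
     closedin (vertex_simplex_topology S) {x \<in> vertex_simplex S. realization_point \<sigma> x \<in> A})"
proof -
  have "openin (vertex_simplex_topology S) {x \<in> vertex_simplex S. realization_point \<sigma> x \<in> realization_points m Y - A}
      \<longleftrightarrow> closedin (vertex_simplex_topology S) {x \<in> vertex_simplex S. realization_point \<sigma> x \<in> A}"
    if "S \<subseteq> {..m}" "labelled_simplex S Y \<sigma>" for S \<sigma>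
  proof -
    have "{x \<in> vertex_simplex S. realization_point \<sigma> x \<in> realization_points m Y - A}
       = topspace (vertex_simplex_topology S) - {x \<in> vertex_simplex S. realization_point \<sigma> x \<in> A}"
      using realization_point_in[OF that] by auto
    then show ?thesis by (simp add: closedin_def)
  qed
  then show ?thesis using assms by (simp add: closedin_def[of "realization m Y"] openin_realization Diff_subset)
qed

lemma continuous_map_realization_point:
  assumes "S \<subseteq> {..m}" "labelled_simplex S Y \<sigma>"
  shows "continuous_map (vertex_simplex_topology S) (realization m Y) (realization_point \<sigma>)"
  using assms realization_point_in[OF assms] by (auto simp: continuous_map_def openin_realization)

lemma continuous_map_from_realization:
  assumes "\<And>S \<sigma>. \<lbrakk>S \<subseteq> {..m}; labelled_simplex S Y \<sigma>\<rbrakk> \<Longrightarrow>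
    continuous_map (vertex_simplex_topology S) Z (\<lambda>x. f (realization_point \<sigma> x))"
  shows "continuous_map (realization m Y) Z f"
  unfolding continuous_map_def
proof (intro conjI allI impI)
  show "f \<in> topspace (realization m Y) \<rightarrow> topspace Z"
  proof
    fix u assume "u \<in> topspace (realization m Y)"
    then obtain S \<sigma> x where u: "u = realization_point \<sigma> x" "S \<subseteq> {..m}" "labelled_simplex S Y \<sigma>" "x \<in> vertex_simplex S"
      by (auto simp: realization_points_def)
    show "f u \<in> topspace Z"
      using continuous_map_image_subset_topspace[OF assms[OF u(2,3)]] u(1,4) by auto
  qed
  fix W assume W: "openin Z W"
  show "openin (realization m Y) {u \<in> topspace (realization m Y). f u \<in> W}"
    unfolding openin_realization
  proof (intro conjI allI impI)
    fix S \<sigma> assume S: "S \<subseteq> {..m} \<and> labelled_simplex S Y \<sigma>"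
    have "{x \<in> vertex_simplex S. realization_point \<sigma> x \<in> {u \<in> topspace (realization m Y). f u \<in> W}}
      = {x \<in> topspace (vertex_simplex_topology S). f (realization_point \<sigma> x) \<in> W}"
      using realization_point_in S by auto
    also have "openin (vertex_simplex_topology S) \<dots>"
      using S W by (intro openin_continuous_map_preimage[OF assms]) auto
    finally show "openin (vertex_simplex_topology S)
      {x \<in> vertex_simplex S. realization_point \<sigma> x \<in> {u \<in> topspace (realization m Y). f u \<in> W}}" .
  qed auto
qed

lemma continuous_map_vertex_simplex_coordinate:
  "continuous_map (vertex_simplex_topology S) euclideanreal (\<lambda>x. x i)"
  by (auto intro: continuous_map_from_subtopology continuous_map_product_projection)

lemma continuous_map_realization_coordinate:
  "continuous_map (realization m Y) euclideanreal (\<lambda>u. snd (snd u) i)"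
  by (rule continuous_map_from_realization) (simp add: realization_point_def continuous_map_vertex_simplex_coordinate)

text \<open>
  Coordinates alone do not separate points, as different simplices may have the same labels. This function is the
  product of the coordinates in \<open>T\<close> on all simplices whose face with vertex set \<open>T\<close> is \<open>\<tau>\<close>, and zero on the others. It
  respects the gluing because the product vanishes wherever a coordinate in \<open>T\<close> does.
\<close>

definition face_bump :: "nat set \<Rightarrow> 'a simplex \<Rightarrow> 'a cw_point \<Rightarrow> real" where
  "face_bump T \<tau> = (\<lambda>(_, s, x). if T \<subseteq> support x \<and> restrict s (vertex_simplex T) = \<tau> then \<Prod>i\<in>T. x i else 0)"

lemma face_bump_realization_point:
  assumes "finite S" "finite T" "x \<in> vertex_simplex S"
  shows "face_bump T \<tau> (realization_point \<sigma> x) = (if restrict \<sigma> (vertex_simplex T) = \<tau> then \<Prod>i\<in>T. x i else 0)"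
proof (cases "T \<subseteq> support x")
  case True
  have fin: "finite (support x)" using support_subset[OF assms(3)] assms(1) by (rule finite_subset)
  have "restrict (restrict \<sigma> (vertex_simplex (support x))) (vertex_simplex T) = restrict \<sigma> (vertex_simplex T)"
    using vertex_simplex_mono[OF fin True] by (auto simp: restrict_def fun_eq_iff)
  then show ?thesis using True by (simp add: face_bump_def realization_point_def)
next
  case False
  then have "(\<Prod>i\<in>T. x i) = 0" using assms(2) by (intro prod_zero) auto
  then show ?thesis using False by (simp add: face_bump_def realization_point_def)
qed

lemma continuous_map_face_bump:
  assumes "finite T"
  shows "continuous_map (realization m Y) euclideanreal (face_bump T \<tau>)"
proof (rule continuous_map_from_realization)
  fix S \<sigma> assume S: "S \<subseteq> {..m}" "labelled_simplex S Y \<sigma>"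
  then have finS: "finite S" using finite_subset by blast
  have "continuous_map (vertex_simplex_topology S) euclideanreal
      (\<lambda>x. if restrict \<sigma> (vertex_simplex T) = \<tau> then \<Prod>i\<in>T. x i else 0)"
    using assms continuous_map_vertex_simplex_coordinate
    by (cases "restrict \<sigma> (vertex_simplex T) = \<tau>") (auto intro!: continuous_map_prod)
  then show "continuous_map (vertex_simplex_topology S) euclideanreal (\<lambda>x. face_bump T \<tau> (realization_point \<sigma> x))"
    by (rule continuous_map_eq) (simp add: face_bump_realization_point[OF finS assms])
qed

lemma Hausdorff_space_if_separated_by_functions:
  assumes "\<And>u v. \<lbrakk>u \<in> topspace X; v \<in> topspace X; u \<noteq> v\<rbrakk> \<Longrightarrow> \<exists>f. continuous_map X euclideanreal f \<and> f u \<noteq> f v"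
  shows "Hausdorff_space X"
  unfolding Hausdorff_space_def
proof (intro allI impI)
  fix u v assume uv: "u \<in> topspace X \<and> v \<in> topspace X \<and> u \<noteq> v"
  then obtain f where f: "continuous_map X euclideanreal f" "f u \<noteq> f v" using assms by blast
  then obtain A B where AB: "open A" "open B" "f u \<in> A" "f v \<in> B" "A \<inter> B = {}"
    using hausdorff[OF f(2)] by blast
  have "openin X {x \<in> topspace X. f x \<in> A}" "openin X {x \<in> topspace X. f x \<in> B}"
    by (rule openin_continuous_map_preimage[OF f(1)]; use AB in simp)+
  then show "\<exists>U V. openin X U \<and> openin X V \<and> u \<in> U \<and> v \<in> V \<and> disjnt U V"
    using uv AB
    by (intro exI[of _ "{x \<in> topspace X. f x \<in> A}"] exI[of _ "{x \<in> topspace X. f x \<in> B}"])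
      (auto simp: disjnt_iff)
qed

text \<open>
  Points with different coordinates are separated by a coordinate function. Points with the same coordinates lie
  in the interiors of different simplices with the same labels and are separated by a bump function of one of them.
\<close>

lemma Hausdorff_space_realization: "Hausdorff_space (realization m Y)"
proof (rule Hausdorff_space_if_separated_by_functions)
  fix u v assume "u \<in> topspace (realization m Y)" "v \<in> topspace (realization m Y)" and uv: "u \<noteq> v"
  then obtain S \<sigma> x T \<tau> y where u: "u = realization_point \<sigma> x" "S \<subseteq> {..m}" "x \<in> vertex_simplex S"
    and v: "v = realization_point \<tau> y" "T \<subseteq> {..m}" "y \<in> vertex_simplex T"
    by (auto simp: realization_points_def)
  have fin: "finite S" "finite T" using u v finite_subset by blast+
  show "\<exists>f. continuous_map (realization m Y) euclideanreal f \<and> f u \<noteq> f v"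
  proof (cases "x = y")
    case False
    then obtain i where "x i \<noteq> y i" by blast
    then show ?thesis
      using continuous_map_realization_coordinate[of m Y i]
      by (intro exI conjI) (auto simp: u v realization_point_def)
  next
    case True
    let ?F = "support x"
    let ?t = "restrict \<tau> (vertex_simplex ?F)"
    have F: "finite ?F" using support_subset[OF u(3)] fin(1) by (rule finite_subset)
    have ne: "restrict \<sigma> (vertex_simplex ?F) \<noteq> ?t" using uv True by (auto simp: u v realization_point_def)
    have "face_bump ?F ?t u = 0"
      by (simp only: u(1) face_bump_realization_point[OF fin(1) F u(3)] ne if_False)
    moreover have "face_bump ?F ?t v = (\<Prod>i\<in>?F. y i)"
      by (simp only: v(1) face_bump_realization_point[OF fin(2) F v(3)] if_True simp_thms)
    moreover have "(\<Prod>i\<in>?F. y i) \<noteq> 0" using F True by simp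
    ultimately have "face_bump ?F ?t u \<noteq> face_bump ?F ?t v" by simp
    then show ?thesis using continuous_map_face_bump[OF F] by blast
  qed
qed

lemma inj_realization_point: "inj (realization_point \<sigma>)"
  by (auto simp: inj_on_def realization_point_def)

lemma embedding_map_realization_point:
  assumes "S \<subseteq> {..m}" "labelled_simplex S Y \<sigma>"
  shows "embedding_map (vertex_simplex_topology S) (realization m Y) (realization_point \<sigma>)"
proof (rule continuous_imp_embedding_map[OF continuous_map_realization_point[OF assms] _ Hausdorff_space_realization])
  show "compact_space (vertex_simplex_topology S)"
    using assms finite_subset by (blast intro: compact_space_vertex_simplex)
  show "inj_on (realization_point \<sigma>) (topspace (vertex_simplex_topology S))"
    using inj_realization_point by (rule inj_on_subset) simp
qed

lemma labelled_simplex_restrict: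
  assumes "labelled_simplex S Y \<sigma>" "T \<subseteq> S" "finite S"
  shows "labelled_simplex T Y (restrict \<sigma> (vertex_simplex T))"
proof -
  have "continuous_map (vertex_simplex_topology T) Y \<sigma>"
    using assms vertex_simplex_mono[of S T] unfolding labelled_simplex_def
    by (meson continuous_map_from_subtopology_mono)
  then have "continuous_map (vertex_simplex_topology T) Y (restrict \<sigma> (vertex_simplex T))"
    by (rule continuous_map_eq) auto
  then show ?thesis by (simp add: labelled_simplex_def)
qed

lemma realization_point_restrict:
  assumes "x \<in> vertex_simplex T" "finite T"
  shows "realization_point (restrict \<sigma> (vertex_simplex T)) x = realization_point \<sigma> x"
  using vertex_simplex_mono[OF assms(2) support_subset[OF assms(1)]]
  by (auto simp: realization_point_def restrict_def fun_eq_iff)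

lemma labelled_simplex_extensional:
  "labelled_simplex S Y \<sigma> \<Longrightarrow> restrict \<sigma> (vertex_simplex S) = \<sigma>"
  by (simp add: labelled_simplex_def extensional_restrict)

definition disc_to_simplex :: "nat set \<Rightarrow> (nat \<Rightarrow> real) \<Rightarrow> nat \<Rightarrow> real" where
  "disc_to_simplex S = (SOME r. homeomorphic_map (disc (card S - 1)) (vertex_simplex_topology S) r \<and>
    (\<forall>w\<in>topspace (disc (card S - 1)). w \<in> open_disc (card S - 1) \<longleftrightarrow> support (r w) = S))"

lemma disc_to_simplex:
  assumes "card S = Suc n"
  shows "homeomorphic_map (disc n) (vertex_simplex_topology S) (disc_to_simplex S)"
    and "w \<in> topspace (disc n) \<Longrightarrow> w \<in> open_disc n \<longleftrightarrow> support (disc_to_simplex S w) = S"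
proof -
  have "finite S" using assms by (metis card.infinite nat.distinct(1))
  from someI_ex[OF disc_homeomorphic_vertex_simplex[OF this assms]]
  show "homeomorphic_map (disc n) (vertex_simplex_topology S) (disc_to_simplex S)"
    and "w \<in> topspace (disc n) \<Longrightarrow> w \<in> open_disc n \<longleftrightarrow> support (disc_to_simplex S w) = S"
    unfolding disc_to_simplex_def assms diff_Suc_1 by blast+
qed

lemma disc_to_simplex_images:
  assumes "card S = Suc n"
  shows "disc_to_simplex S ` open_disc n = {x \<in> vertex_simplex S. support x = S}"
    and "disc_to_simplex S ` disc_boundary n = {x \<in> vertex_simplex S. support x \<noteq> S}"
proof -
  note r = disc_to_simplex[OF assms]
  have im: "disc_to_simplex S ` topspace (disc n) = vertex_simplex S"
    using homeomorphic_imp_surjective_map[OF r(1)] by simp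
  have restrict_image: "r ` A = {x \<in> V. P x}" if "A = {w \<in> D. P (r w)}" "r ` D = V" for r :: "(nat \<Rightarrow> real) \<Rightarrow> nat \<Rightarrow> real" and A V D P
    using that by blast
  have "open_disc n = {w \<in> topspace (disc n). support (disc_to_simplex S w) = S}"
    using r(2) unfolding open_disc_def by blast
  then show "disc_to_simplex S ` open_disc n = {x \<in> vertex_simplex S. support x = S}"
    using im by (rule restrict_image)
  have "disc_boundary n = {w \<in> topspace (disc n). support (disc_to_simplex S w) \<noteq> S}"
    using r(2) in_disc_boundary_iff by blast
  then show "disc_to_simplex S ` disc_boundary n = {x \<in> vertex_simplex S. support x \<noteq> S}"
    using im by (rule restrict_image)
qed

definition realization_cells :: "nat \<Rightarrow> 'a topology \<Rightarrow> nat \<Rightarrow> ((nat \<Rightarrow> real) \<Rightarrow> 'a cw_point) set" where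
  "realization_cells m Y n =
     {realization_point \<sigma> \<circ> disc_to_simplex S | S \<sigma>. S \<subseteq> {..m} \<and> card S = Suc n \<and> labelled_simplex S Y \<sigma>}"

lemma realization_cell_image:
  assumes "card S = Suc n"
  shows "(realization_point \<sigma> \<circ> disc_to_simplex S) ` open_disc n =
    realization_point \<sigma> ` {x \<in> vertex_simplex S. support x = S}"
  unfolding image_comp[symmetric] disc_to_simplex_images(1)[OF assms] ..

lemma realization_points_eq_cells:
  assumes "u \<in> realization_points m Y"
  obtains S \<sigma> x where "S \<subseteq> {..m}" "card S = Suc (card S - 1)" "labelled_simplex S Y \<sigma>" "x \<in> vertex_simplex S"
    "support x = S" "u = realization_point \<sigma> x"
proof -
  obtain T \<tau> x where T: "u = realization_point \<tau> x" "T \<subseteq> {..m}" "labelled_simplex T Y \<tau>" "x \<in> vertex_simplex T"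
    using assms by (auto simp: realization_points_def)
  have finT: "finite T" using T finite_subset by blast
  let ?S = "support x"
  have S: "?S \<subseteq> T" using support_subset T by blast
  then have finS: "finite ?S" using finT finite_subset by blast
  have xS: "x \<in> vertex_simplex ?S" by (rule in_vertex_simplex_support[OF finT T(4)])
  then have "?S \<noteq> {}" using vertex_simplex_empty by (metis empty_iff)
  then have "card ?S = Suc (card ?S - 1)" using finS by (simp add: card_gt_0_iff)
  then show thesis
    using that[of ?S "restrict \<tau> (vertex_simplex ?S)" x] S T xS finT finS
      labelled_simplex_restrict[OF T(3) S finT] realization_point_restrict[OF xS finS, of \<tau>]
    by auto
qed

lemma embedding_imp_continuous_map: "embedding_map X Y f \<Longrightarrow> continuous_map X Y f"
  unfolding embedding_map_def using homeomorphic_imp_continuous_map continuous_map_into_fulltopology by blast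

lemma realization_cell_homeomorphism:
  assumes S: "S \<subseteq> {..m}" "card S = Suc n" "labelled_simplex S Y \<sigma>"
    and f: "f = realization_point \<sigma> \<circ> disc_to_simplex S"
  shows "continuous_map (disc n) (realization m Y) f"
    and "homeomorphic_map (subtopology (disc n) (open_disc n)) (subtopology (realization m Y) (f ` open_disc n)) f"
proof -
  have "embedding_map (disc n) (vertex_simplex_topology S) (disc_to_simplex S)"
    using disc_to_simplex(1)[OF S(2)] surjective_embedding_map by blast
  then have emb: "embedding_map (disc n) (realization m Y) f"
    unfolding f by (rule embedding_map_compose[OF _ embedding_map_realization_point[OF S(1,3)]])
  then show cont: "continuous_map (disc n) (realization m Y) f" by (rule embedding_imp_continuous_map)
  have sub: "open_disc n \<subseteq> topspace (disc n)" by (auto simp: open_disc_def)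
  have "homeomorphic_map (subtopology (disc n) (open_disc n))
      (subtopology (subtopology (realization m Y) (f ` topspace (disc n))) (f ` open_disc n)) f"
  proof (rule homeomorphic_map_subtopologies)
    show "homeomorphic_map (disc n) (subtopology (realization m Y) (f ` topspace (disc n))) f"
      using emb by (simp only: embedding_map_def)
    show "f ` (topspace (disc n) \<inter> open_disc n) =
        topspace (subtopology (realization m Y) (f ` topspace (disc n))) \<inter> f ` open_disc n"
      using continuous_map_image_subset_topspace[OF cont] sub unfolding topspace_subtopology by blast
  qed
  moreover have "f ` topspace (disc n) \<inter> f ` open_disc n = f ` open_disc n"
    using sub by blast
  ultimately show "homeomorphic_map (subtopology (disc n) (open_disc n)) (subtopology (realization m Y) (f ` open_disc n)) f"
    by (simp only: subtopology_subtopology)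
qed

text \<open>
  A boundary point lies in the interior of the face spanned by its support, so the cells of the proper
  faces suffice.
\<close>

lemma realization_cell_boundary:
  assumes S: "S \<subseteq> {..m}" "card S = Suc n" "labelled_simplex S Y \<sigma>"
    and f: "f = realization_point \<sigma> \<circ> disc_to_simplex S"
  shows "\<exists>F. finite F \<and> F \<subseteq> (SIGMA k:{..<n}. realization_cells m Y k) \<and>
        f ` disc_boundary n \<subseteq> (\<Union>(k, g)\<in>F. g ` open_disc k)"
proof -
  have finS: "finite S" using S finite_subset by blast
  define cell where "cell T = (card T - 1, realization_point (restrict \<sigma> (vertex_simplex T)) \<circ> disc_to_simplex T)" for T
  show ?thesis
  proof (intro exI conjI)
    let ?F = "cell ` {T. T \<subset> S \<and> T \<noteq> {}}"
    have card: "card T = Suc (card T - 1)" "card T - 1 < n" if T: "T \<subset> S" "T \<noteq> {}" for T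
    proof -
      have lt: "card T < Suc n" using psubset_card_mono[OF finS T(1)] S(2) by simp
      have "finite T" using T(1) finS finite_subset by blast
      then have pos: "card T > 0" using T(2) by (simp add: card_gt_0_iff)
      show "card T = Suc (card T - 1)" using pos by simp
      show "card T - 1 < n" using lt pos by simp
    qed
    show "finite ?F" by (rule finite_imageI, rule finite_subset[of _ "Pow S"]) (use finS in auto)
    show "?F \<subseteq> (SIGMA k:{..<n}. realization_cells m Y k)"
    proof (rule image_subsetI)
      fix T assume "T \<in> {T. T \<subset> S \<and> T \<noteq> {}}"
      then have T: "T \<subset> S" "T \<noteq> {}" "T \<subseteq> S" "T \<subseteq> {..m}" using S(1) by auto
      have "realization_point (restrict \<sigma> (vertex_simplex T)) \<circ> disc_to_simplex T \<in> realization_cells m Y (card T - 1)"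
        unfolding realization_cells_def
        using T(4) card(1)[OF T(1,2)] labelled_simplex_restrict[OF S(3) T(3) finS] by blast
      then show "cell T \<in> (SIGMA k:{..<n}. realization_cells m Y k)"
        unfolding cell_def using card(2)[OF T(1,2)] by (intro SigmaI) simp_all
    qed
    show "f ` disc_boundary n \<subseteq> (\<Union>(k, g)\<in>?F. g ` open_disc k)"
    proof
      fix u assume "u \<in> f ` disc_boundary n"
      then obtain x where x: "x \<in> vertex_simplex S" "support x \<noteq> S" "u = realization_point \<sigma> x"
        unfolding f image_comp[symmetric] disc_to_simplex_images(2)[OF S(2)] by blast
      let ?T = "support x"
      have xT: "x \<in> vertex_simplex ?T" by (rule in_vertex_simplex_support[OF finS x(1)])
      have "?T \<noteq> {}"
      proof
        assume "?T = {}"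
        then show False using xT by (simp only: vertex_simplex_empty empty_iff)
      qed
      then have T: "?T \<subset> S" "?T \<noteq> {}" using support_subset[OF x(1)] x(2) by blast+
      then have finT: "finite ?T" using finS finite_subset by blast
      have "u = realization_point (restrict \<sigma> (vertex_simplex ?T)) x"
        by (rule trans[OF x(3) realization_point_restrict[OF xT finT, symmetric]])
      then have "u \<in> (realization_point (restrict \<sigma> (vertex_simplex ?T)) \<circ> disc_to_simplex ?T) ` open_disc (card ?T - 1)"
        unfolding realization_cell_image[OF card(1)[OF T]] using xT by blast
      then show "u \<in> (\<Union>(k, g)\<in>?F. g ` open_disc k)"
        using T by (intro UN_I[of "cell ?T"]) (simp_all add: cell_def)
    qed
  qed
qed

lemma Union_realization_cells:
  "(\<Union>n. \<Union>f\<in>realization_cells m Y n. f ` open_disc n) = topspace (realization m Y)"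
proof (intro equalityI subsetI)
  fix u assume "u \<in> (\<Union>n. \<Union>f\<in>realization_cells m Y n. f ` open_disc n)"
  then obtain n S \<sigma> where S: "S \<subseteq> {..m}" "card S = Suc n" "labelled_simplex S Y \<sigma>"
    and u: "u \<in> (realization_point \<sigma> \<circ> disc_to_simplex S) ` open_disc n"
    unfolding realization_cells_def by blast
  then show "u \<in> topspace (realization m Y)"
    using realization_point_in[OF S(1,3)] unfolding realization_cell_image[OF S(2)] topspace_realization by blast
next
  fix u assume "u \<in> topspace (realization m Y)"
  then obtain S \<sigma> x where S: "S \<subseteq> {..m}" "card S = Suc (card S - 1)" "labelled_simplex S Y \<sigma>"
    "x \<in> vertex_simplex S" "support x = S" "u = realization_point \<sigma> x"
    using realization_points_eq_cells by (metis topspace_realization)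
  then have "u \<in> (realization_point \<sigma> \<circ> disc_to_simplex S) ` open_disc (card S - 1)"
    unfolding realization_cell_image[OF S(2)] by blast
  moreover have "realization_point \<sigma> \<circ> disc_to_simplex S \<in> realization_cells m Y (card S - 1)"
    using S unfolding realization_cells_def by blast
  ultimately show "u \<in> (\<Union>n. \<Union>f\<in>realization_cells m Y n. f ` open_disc n)" by blast
qed

lemma disjoint_realization_cells:
  "disjoint_family_on (\<lambda>(n, f). f ` open_disc n) (SIGMA n:UNIV. realization_cells m Y n)"
proof -
  have "(n, f) = (n', f')"
    if f_cell: "f \<in> realization_cells m Y n" and f'_cell: "f' \<in> realization_cells m Y n'"
      and u: "u \<in> f ` open_disc n" and u': "u \<in> f' ` open_disc n'" for n f n' f' u
  proof -
    obtain S \<sigma> where f: "f = realization_point \<sigma> \<circ> disc_to_simplex S" "card S = Suc n" "labelled_simplex S Y \<sigma>"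
      using f_cell unfolding realization_cells_def by blast
    obtain S' \<sigma>' where f': "f' = realization_point \<sigma>' \<circ> disc_to_simplex S'" "card S' = Suc n'" "labelled_simplex S' Y \<sigma>'"
      using f'_cell unfolding realization_cells_def by blast
    obtain x where x: "support x = S" "u = realization_point \<sigma> x"
      using u unfolding f(1) realization_cell_image[OF f(2)] by blast
    obtain x' where x': "support x' = S'" "u = realization_point \<sigma>' x'"
      using u' unfolding f'(1) realization_cell_image[OF f'(2)] by blast
    have "u = (0, \<sigma>, x)" using x labelled_simplex_extensional[OF f(3)] by (simp add: realization_point_def)
    moreover have "u = (0, \<sigma>', x')" using x' labelled_simplex_extensional[OF f'(3)] by (simp add: realization_point_def)
    ultimately have eq: "(0::nat, \<sigma>, x) = (0, \<sigma>', x')" by (rule trans[OF sym])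
    then have \<sigma>: "\<sigma> = \<sigma>'" and "x = x'" by simp_all
    then have S: "S = S'" using x(1) x'(1) by (simp only:)
    then have "n = n'" using f(2) f'(2) by simp
    then show ?thesis by (simp only: f(1) f'(1) \<sigma> S)
  qed
  note same = this
  show ?thesis
    unfolding disjoint_family_on_def
  proof (intro ballI impI)
    fix a b assume ab: "a \<in> (SIGMA n:UNIV. realization_cells m Y n)" "b \<in> (SIGMA n:UNIV. realization_cells m Y n)" "a \<noteq> b"
    obtain n f n' f' where a: "a = (n, f)" and b: "b = (n', f')" by (cases a, cases b)
    have "f \<in> realization_cells m Y n" "f' \<in> realization_cells m Y n'" using ab a b by blast+
    then show "(case a of (n, f) \<Rightarrow> f ` open_disc n) \<inter> (case b of (n, f) \<Rightarrow> f ` open_disc n) = {}"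
      using same ab(3) unfolding a b prod.case by blast
  qed
qed

lemma closedin_realization_iff_cells:
  assumes A: "A \<subseteq> topspace (realization m Y)"
  shows "closedin (realization m Y) A \<longleftrightarrow>
        (\<forall>n. \<forall>f\<in>realization_cells m Y n. closedin (disc n) {x \<in> topspace (disc n). f x \<in> A})"
proof -
  have cell: "closedin (disc n) {w \<in> topspace (disc n). (realization_point \<sigma> \<circ> disc_to_simplex S) w \<in> A}
      \<longleftrightarrow> closedin (vertex_simplex_topology S) {x \<in> vertex_simplex S. realization_point \<sigma> x \<in> A}"
    if "card S = Suc n" for S \<sigma> n
  proof -
    have q: "quotient_map (disc n) (vertex_simplex_topology S) (disc_to_simplex S)"
      using disc_to_simplex(1)[OF that] unfolding homeomorphic_map_def by (rule conjunct1)
    have "disc_to_simplex S w \<in> vertex_simplex S" if "w \<in> topspace (disc n)" for w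
      using quotient_imp_surjective_map[OF q] that by auto
    then have eq: "{w \<in> topspace (disc n). (realization_point \<sigma> \<circ> disc_to_simplex S) w \<in> A}
      = {w \<in> topspace (disc n). disc_to_simplex S w \<in> {x \<in> vertex_simplex S. realization_point \<sigma> x \<in> A}}"
      by auto
    have "{x \<in> vertex_simplex S. realization_point \<sigma> x \<in> A} \<subseteq> topspace (vertex_simplex_topology S)"
      by auto
    from q[unfolded quotient_map_closedin, THEN conjunct2, rule_format, OF this]
    show ?thesis unfolding eq .
  qed
  have empty: "closedin (vertex_simplex_topology S) {x \<in> vertex_simplex S. realization_point \<sigma> x \<in> A}" if "S = {}" for S \<sigma>
    using that by (simp add: vertex_simplex_def)
  show "closedin (realization m Y) A \<longleftrightarrow>
        (\<forall>n. \<forall>f\<in>realization_cells m Y n. closedin (disc n) {x \<in> topspace (disc n). f x \<in> A})"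
    (is "_ \<longleftrightarrow> ?cells")
  proof
    assume L: "closedin (realization m Y) A"
    show ?cells
    proof (intro allI ballI)
      fix n f assume "f \<in> realization_cells m Y n"
      then obtain S \<sigma> where f: "f = realization_point \<sigma> \<circ> disc_to_simplex S"
        and S: "S \<subseteq> {..m}" "card S = Suc n" "labelled_simplex S Y \<sigma>"
        unfolding realization_cells_def by blast
      show "closedin (disc n) {x \<in> topspace (disc n). f x \<in> A}"
        unfolding f cell[OF S(2)] using L A S by (simp add: closedin_realization)
    qed
  next
    assume R: ?cells
    have "closedin (vertex_simplex_topology S) {x \<in> vertex_simplex S. realization_point \<sigma> x \<in> A}"
      if S: "S \<subseteq> {..m}" "labelled_simplex S Y \<sigma>" for S \<sigma>
    proof (cases "S = {}")
      case False
      have "finite S" using S finite_subset by blast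
      then obtain n where n: "card S = Suc n" using False by (metis card_gt_0_iff gr0_implies_Suc)
      have "realization_point \<sigma> \<circ> disc_to_simplex S \<in> realization_cells m Y n"
        using S n unfolding realization_cells_def by blast
      then show ?thesis using R cell[OF n, of \<sigma>] by blast
    qed (rule empty)
    then show "closedin (realization m Y) A" using A by (simp add: closedin_realization)
  qed
qed

lemma cw_structure_realization: "cw_structure (realization m Y) (realization_cells m Y)"
proof -
  have cellE: thesis
    if "f \<in> realization_cells m Y n" and
      "\<And>S \<sigma>. \<lbrakk>S \<subseteq> {..m}; card S = Suc n; labelled_simplex S Y \<sigma>; f = realization_point \<sigma> \<circ> disc_to_simplex S\<rbrakk> \<Longrightarrow> thesis"
    for n f thesis
    using that unfolding realization_cells_def by blast
  show ?thesis
    unfolding cw_structure_def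
  proof (intro conjI allI ballI impI)
    fix n f assume f: "f \<in> realization_cells m Y n"
    show "continuous_map (disc n) (realization m Y) f"
      by (rule cellE[OF f]) (rule realization_cell_homeomorphism(1))
    show "homeomorphic_map (subtopology (disc n) (open_disc n)) (subtopology (realization m Y) (f ` open_disc n)) f"
      by (rule cellE[OF f]) (rule realization_cell_homeomorphism(2))
    show "\<exists>F. finite F \<and> F \<subseteq> (SIGMA k:{..<n}. realization_cells m Y k) \<and>
        f ` disc_boundary n \<subseteq> (\<Union>(k, g)\<in>F. g ` open_disc k)"
      by (rule cellE[OF f]) (rule realization_cell_boundary)
  qed (rule Hausdorff_space_realization Union_realization_cells disjoint_realization_cells
      closedin_realization_iff_cells | assumption)+
qed

lemma cw_complex_of_dim_realization:
  assumes "topspace Y \<noteq> {}"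
  shows "cw_complex_of_dim m (realization m Y)"
  unfolding cw_complex_of_dim_def
proof (intro exI conjI allI impI)
  show "cw_structure (realization m Y) (realization_cells m Y)" by (rule cw_structure_realization)
  obtain a where a: "a \<in> topspace Y" using assms by blast
  have "labelled_simplex {..m} Y (restrict (\<lambda>_. a) (vertex_simplex {..m}))"
    using a by (simp add: labelled_simplex_def)
  moreover have "card {..m} = Suc m" by simp
  ultimately show "realization_cells m Y m \<noteq> {}" unfolding realization_cells_def by blast
  fix n assume "m < n"
  then have "card S \<noteq> Suc n" if "S \<subseteq> {..m}" for S using card_mono[OF _ that] by simp
  then show "realization_cells m Y n = {}" unfolding realization_cells_def by blast
qed

definition realization_eval :: "'a cw_point \<Rightarrow> 'a" where
  "realization_eval = (\<lambda>(_, s, x). s x)"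

lemma realization_eval_point:
  assumes "finite S" "x \<in> vertex_simplex S"
  shows "realization_eval (realization_point \<sigma> x) = \<sigma> x"
  using in_vertex_simplex_support[OF assms] by (simp add: realization_eval_def realization_point_def)

lemma continuous_map_realization_eval: "continuous_map (realization m Y) Y realization_eval"
proof (rule continuous_map_from_realization)
  fix S \<sigma> assume S: "S \<subseteq> {..m}" "labelled_simplex S Y \<sigma>"
  have "finite S" using S finite_subset by blast
  show "continuous_map (vertex_simplex_topology S) Y (\<lambda>x. realization_eval (realization_point \<sigma> x))"
  proof (rule continuous_map_eq)
    show "continuous_map (vertex_simplex_topology S) Y \<sigma>" using S by (simp only: labelled_simplex_def)
    fix x assume "x \<in> topspace (vertex_simplex_topology S)"
    then show "\<sigma> x = realization_eval (realization_point \<sigma> x)"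
      using realization_eval_point[OF \<open>finite S\<close>, of x \<sigma>] by simp
  qed
qed

section \<open>Lifting subdivided chains to the realization\<close>

text \<open>
  The subdivision lists the vertices of a simplex from the barycentre of the whole simplex down to an original vertex, so
  the number of a vertex is its codimension. The label is to be the dimension, whence the order is reversed.
\<close>

definition flip :: "nat \<Rightarrow> (nat \<Rightarrow> real) \<Rightarrow> nat \<Rightarrow> real" where
  "flip p x = (\<lambda>i. if i \<le> p then x (p - i) else 0)"

lemma flip_in_standard_simplex:
  assumes "x \<in> standard_simplex p"
  shows "flip p x \<in> standard_simplex p"
proof -
  have "(\<Sum>i\<le>p. flip p x i) = (\<Sum>i\<le>p. x (p - i))" by (simp add: flip_def)
  also have "\<dots> = (\<Sum>i\<le>p. x i)"
    by (rule sum.reindex_bij_witness[where i = "\<lambda>i. p - i" and j = "\<lambda>i. p - i"]) auto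
  finally show ?thesis using assms by (simp add: standard_simplex_def flip_def)
qed

lemma flip_flip:
  assumes "x \<in> standard_simplex p"
  shows "flip p (flip p x) = x"
  using assms by (auto simp: flip_def standard_simplex_def fun_eq_iff)

lemma continuous_map_flip: "continuous_map (simplex_topology p) (simplex_topology p) (flip p)"
proof -
  have "continuous_map (simplex_topology p) euclideanreal (\<lambda>x. flip p x i)" for i
    by (cases "i \<le> p") (auto simp: flip_def intro: continuous_map_from_subtopology continuous_map_product_projection)
  then show ?thesis
    by (auto simp: continuous_map_in_subtopology continuous_map_componentwise_UNIV flip_in_standard_simplex)
qed

definition lift_simplex :: "nat \<Rightarrow> 'a simplex \<Rightarrow> 'a cw_point simplex" where
  "lift_simplex p \<rho> = (\<lambda>x\<in>standard_simplex p. realization_point (\<rho> \<circ> flip p) (flip p x))"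

lemma singular_simplex_lift_simplex:
  assumes "singular_simplex p Y \<rho>" "p \<le> m"
  shows "singular_simplex p (realization m Y) (lift_simplex p \<rho>)"
proof -
  let ?\<sigma> = "restrict (\<rho> \<circ> flip p) (vertex_simplex {..p})"
  have "continuous_map (simplex_topology p) Y (\<rho> \<circ> flip p)"
    using assms(1) continuous_map_flip by (auto simp: singular_simplex_def intro: continuous_map_compose)
  then have "continuous_map (vertex_simplex_topology {..p}) Y ?\<sigma>"
    unfolding vertex_simplex_atMost by (rule continuous_map_eq) simp
  then have "labelled_simplex {..p} Y ?\<sigma>" by (simp add: labelled_simplex_def)
  then have "continuous_map (simplex_topology p) (realization m Y) (realization_point ?\<sigma>)"
    using continuous_map_realization_point[of "{..p}" m Y ?\<sigma>] assms(2) by (simp add: vertex_simplex_atMost)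
  then have "continuous_map (simplex_topology p) (realization m Y) (realization_point ?\<sigma> \<circ> flip p)"
    using continuous_map_flip continuous_map_compose by blast
  then have "continuous_map (simplex_topology p) (realization m Y) (lift_simplex p \<rho>)"
  proof (rule continuous_map_eq)
    fix x assume "x \<in> topspace (simplex_topology p)"
    then have x: "x \<in> standard_simplex p" by simp
    then have "flip p x \<in> vertex_simplex {..p}"
      unfolding vertex_simplex_atMost by (rule flip_in_standard_simplex)
    from realization_point_restrict[OF this, of "\<rho> \<circ> flip p"]
    show "(realization_point ?\<sigma> \<circ> flip p) x = lift_simplex p \<rho> x"
      using x by (simp add: lift_simplex_def)
  qed
  then show ?thesis by (simp add: singular_simplex_def lift_simplex_def)
qed

lemma simplex_map_realization_eval_lift_simplex:
  assumes "singular_simplex p Y \<rho>"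
  shows "simplex_map p realization_eval (lift_simplex p \<rho>) = \<rho>"
proof
  fix x
  show "simplex_map p realization_eval (lift_simplex p \<rho>) x = \<rho> x"
  proof (cases "x \<in> standard_simplex p")
    case True
    then have "flip p x \<in> vertex_simplex {..p}"
      unfolding vertex_simplex_atMost by (rule flip_in_standard_simplex)
    then show ?thesis
      using True by (simp add: simplex_map_def lift_simplex_def realization_eval_point[of "{..p}"] flip_flip)
  next
    case False
    then show ?thesis using assms by (simp add: simplex_map_def singular_simplex_def extensional_def)
  qed
qed

definition skip_coordinate :: "nat \<Rightarrow> (nat \<Rightarrow> real) \<Rightarrow> nat \<Rightarrow> real" where
  "skip_coordinate k y = (\<lambda>i. if i < k then y i else y (Suc i))"

lemma simplical_face_skip_coordinate:
  "y k = 0 \<Longrightarrow> simplical_face k (skip_coordinate k y) = y"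
  by (auto simp: simplical_face_def skip_coordinate_def fun_eq_iff)

lemma skip_coordinate_in_standard_simplex:
  assumes y: "y \<in> standard_simplex (Suc p)" "y k = 0" and k: "k \<le> Suc p"
  shows "skip_coordinate k y \<in> standard_simplex p"
proof -
  have "(\<Sum>i\<le>p. skip_coordinate k y i) = (\<Sum>i\<in>{..Suc p} - {k}. y i)"
    using k by (intro sum.reindex_bij_witness[where i = "\<lambda>i. if i < k then i else i - 1" and j = "\<lambda>i. if i < k then i else Suc i"])
      (auto simp: skip_coordinate_def)
  also have "\<dots> = (\<Sum>i\<le>Suc p. y i)"
    using y(2) k by (subst (2) sum.remove[of _ k]) (simp_all del: sum.atMost_Suc)
  finally show ?thesis using y(1) k by (auto simp: standard_simplex_def skip_coordinate_def)
qed

text \<open>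
  Face \<open>k\<close> of a lifted simplex keeps the labels other than \<open>p + 1 - k\<close>. What matters is that it depends only on \<open>k\<close> and face
  \<open>k\<close> of the simplex; then it can be applied to chains of faces, in particular to those that are zero.
\<close>

definition lift_face :: "nat \<Rightarrow> nat \<Rightarrow> 'a simplex \<Rightarrow> 'a cw_point simplex" where
  "lift_face p k \<tau> = (\<lambda>x\<in>standard_simplex p.
     realization_point (\<lambda>z. \<tau> (skip_coordinate k (flip (Suc p) z))) (flip (Suc p) (simplical_face k x)))"

lemma singular_face_lift_simplex:
  assumes k: "k \<le> Suc p"
  shows "singular_face (Suc p) k (lift_simplex (Suc p) \<rho>) = lift_face p k (singular_face (Suc p) k \<rho>)"
proof
  fix x
  show "singular_face (Suc p) k (lift_simplex (Suc p) \<rho>) x = lift_face p k (singular_face (Suc p) k \<rho>) x"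
  proof (cases "x \<in> standard_simplex p")
    case True
    let ?w = "flip (Suc p) (simplical_face k x)"
    have dx: "simplical_face k x \<in> standard_simplex (Suc p)"
      using simplical_face_in_standard_simplex[of "Suc p" k x] True k by simp
    then have w: "?w \<in> vertex_simplex {..Suc p}"
      unfolding vertex_simplex_atMost by (rule flip_in_standard_simplex)
    have eq: "(\<rho> \<circ> flip (Suc p)) z = singular_face (Suc p) k \<rho> (skip_coordinate k (flip (Suc p) z))"
      if z: "z \<in> vertex_simplex (support ?w)" for z
    proof -
      have "z \<in> standard_simplex (Suc p)"
        using z vertex_simplex_mono[OF _ support_subset[OF w]] vertex_simplex_atMost[of "Suc p"] by auto
      then have y: "flip (Suc p) z \<in> standard_simplex (Suc p)" by (rule flip_in_standard_simplex)
      have "?w (Suc p - k) = 0" using k by (simp add: flip_def simplical_face_def)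
      then have "z (Suc p - k) = 0" using support_subset[OF z] by blast
      then have y0: "flip (Suc p) z k = 0" using k by (simp add: flip_def)
      show ?thesis
        using skip_coordinate_in_standard_simplex[OF y y0 k] simplical_face_skip_coordinate[of "flip (Suc p) z", OF y0]
        by (simp add: singular_face_def)
    qed
    have "restrict (\<rho> \<circ> flip (Suc p)) (vertex_simplex (support ?w))
        = restrict (\<lambda>z. singular_face (Suc p) k \<rho> (skip_coordinate k (flip (Suc p) z))) (vertex_simplex (support ?w))"
      by (rule restrict_ext) (rule eq)
    then have "realization_point (\<rho> \<circ> flip (Suc p)) ?w
        = realization_point (\<lambda>z. singular_face (Suc p) k \<rho> (skip_coordinate k (flip (Suc p) z))) ?w"
      unfolding realization_point_def by (simp only:)
    moreover have "singular_face (Suc p) k (lift_simplex (Suc p) \<rho>) x = realization_point (\<rho> \<circ> flip (Suc p)) ?w"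
      using True dx by (simp add: singular_face_def lift_simplex_def)
    ultimately show ?thesis using True by (simp only: lift_face_def restrict_apply if_True)
  next
    case False
    then show ?thesis by (simp add: singular_face_def lift_face_def)
  qed
qed

text \<open>
  Face \<open>0\<close> omits the largest label, so the labels of the remaining vertices are again \<open>0, ..., p\<close>.
\<close>

lemma lift_face_0: "lift_face p 0 \<tau> = lift_simplex p \<tau>"
proof -
  have "skip_coordinate 0 (flip (Suc p) z) = flip p z" for z
    by (auto simp: skip_coordinate_def flip_def fun_eq_iff)
  moreover have "flip (Suc p) (simplical_face 0 x) = flip p x" for x :: "nat \<Rightarrow> real"
    by (auto simp: simplical_face_def flip_def fun_eq_iff Suc_diff_le)
  ultimately show ?thesis by (simp only: lift_face_def lift_simplex_def o_def)
qed

definition lift_chain :: "nat \<Rightarrow> 'a chain \<Rightarrow> 'a cw_point chain" where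
  "lift_chain p = frag_extend (\<lambda>\<rho>. frag_of (lift_simplex p \<rho>))"

lemma lift_chain_diff: "lift_chain p (c - d) = lift_chain p c - lift_chain p d"
  by (simp add: lift_chain_def frag_extend_diff)

lemma lift_chain_of: "lift_chain p (frag_of \<rho>) = frag_of (lift_simplex p \<rho>)"
  by (simp add: lift_chain_def)

lemma lift_chain_0: "lift_chain p 0 = 0"
  by (simp add: lift_chain_def)

lemma singular_chain_lift_chain:
  assumes "singular_chain p Y c" "p \<le> m"
  shows "singular_chain p (realization m Y) (lift_chain p c)"
  unfolding lift_chain_def
proof (rule singular_chain_extend)
  fix \<rho> assume "\<rho> \<in> Poly_Mapping.keys c"
  then have "singular_simplex p Y \<rho>" using assms(1) by (auto simp: singular_chain_def)
  then show "singular_chain p (realization m Y) (frag_of (lift_simplex p \<rho>))"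
    using assms(2) by (simp add: singular_chain_of singular_simplex_lift_simplex)
qed

lemma chain_map_realization_eval_lift_chain:
  assumes "singular_chain p Y c"
  shows "chain_map p realization_eval (lift_chain p c) = c"
  using assms unfolding singular_chain_def
  by (induction c rule: frag_induction)
    (simp_all add: lift_chain_diff lift_chain_of lift_chain_0 chain_map_diff simplex_map_realization_eval_lift_simplex)

lemma chain_face_lift_chain:
  assumes "k \<le> Suc p"
  shows "chain_face (Suc p) k (lift_chain (Suc p) c) = frag_extend (\<lambda>\<tau>. frag_of (lift_face p k \<tau>)) (chain_face (Suc p) k c)"
proof -
  have "Poly_Mapping.keys c \<subseteq> UNIV" by simp
  then show ?thesis
    by (induction c rule: frag_induction)
      (simp_all add: lift_chain_diff lift_chain_of lift_chain_0 chain_face_diff frag_extend_diff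
        singular_face_lift_simplex[OF assms])
qed

text \<open>
  Faces with a gap in their labels do not come from lifted simplices, but in a subdivision they cancel.
\<close>

lemma chain_boundary_lift_subdivision:
  assumes c: "singular_chain (Suc p) Y c"
  shows "chain_boundary (Suc p) (lift_chain (Suc p) (singular_subdivision (Suc p) c))
    = lift_chain p (singular_subdivision p (chain_boundary (Suc p) c))"
proof -
  let ?f = "\<lambda>k. chain_face (Suc p) k (lift_chain (Suc p) (singular_subdivision (Suc p) c))"
  have "?f (Suc k) = 0" if "k \<le> p" for k
    using that by (simp add: chain_face_lift_chain chain_face_singular_subdivision(1)[OF c])
  then have "chain_boundary (Suc p) (lift_chain (Suc p) (singular_subdivision (Suc p) c)) = ?f 0"
    unfolding chain_boundary_eq_sum_chain_face by (simp add: sum.atMost_Suc_shift del: sum.atMost_Suc)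
  also have "\<dots> = lift_chain p (singular_subdivision p (chain_boundary (Suc p) c))"
    by (simp only: chain_face_lift_chain[OF le0] chain_face_singular_subdivision(2)[OF c] lift_face_0)
      (simp only: lift_chain_def)
  finally show ?thesis .
qed

section \<open>Cohomology classes on m-categorical sets\<close>

text \<open>
  With \<open>s = lift(sd \<sigma>)\<close> one has \<open>sd \<sigma> = \<partial>(K s) + K(\<partial>s)\<close> and \<open>sd \<sigma> - \<sigma> = \<partial>(h \<sigma>) + h(\<partial>\<sigma>)\<close>. A cocycle vanishes on
  boundaries, so \<open>c \<sigma>\<close> is the value of \<open>c\<close> on \<open>K(\<partial>s) - h(\<partial>\<sigma>)\<close>, and \<open>\<partial>s = lift(sd(\<partial>\<sigma>))\<close>.
\<close>

lemma m_categorical_imp_cocycle_coboundary_on: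
  fixes c :: "('a, 'r::{comm_ring, comm_monoid_mult}) cochain"
  assumes cat: "m_categorical m X U" and p: "Suc p \<le> m" and c: "c \<in> singular_cocycles (Suc p) X"
  obtains b where "b \<in> singular_cochains p X"
    and "\<And>\<sigma>. singular_simplex (Suc p) (subtopology X U) \<sigma> \<Longrightarrow> c \<sigma> = coboundary p X b \<sigma>"
proof (cases "topspace (subtopology X U) = {}")
  case True
  then have "\<not> singular_simplex (Suc p) (subtopology X U) \<sigma>" for \<sigma> by (rule singular_simplex_empty)
  then show ?thesis by (intro that[of "\<lambda>_. 0"]) (auto simp: singular_cochains_def)
next
  case False
  define Y where "Y = subtopology X U"
  define sd where "sd = (singular_subdivision :: nat \<Rightarrow> 'a chain \<Rightarrow> 'a chain)"
  have "nullhomotopic (realization m Y) X realization_eval"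
    using cat cw_complex_of_dim_realization[of Y m] continuous_map_realization_eval[of m Y] False
    unfolding m_categorical_def Y_def by blast
  then obtain K where K_diff: "\<And>q d e. K q (d - e) = K q d - K q e"
    and K_chain: "\<And>q d. singular_chain q (realization m Y) d \<Longrightarrow> singular_chain (Suc q) X (K q d)"
    and K_bd: "\<And>q d. singular_chain (Suc q) (realization m Y) d \<Longrightarrow>
      chain_boundary (Suc (Suc q)) (K (Suc q) d) = chain_map (Suc q) realization_eval d - K q (chain_boundary (Suc q) d)"
    by (rule nullhomotopic_imp_cone_operator) blast
  obtain h :: "nat \<Rightarrow> 'a chain \<Rightarrow> 'a chain" where hdiff: "\<And>p c1 c2. h p (c1 - c2) = h p c1 - h p c2"
    and hchain: "\<And>p X c. singular_chain p X c \<Longrightarrow> singular_chain (Suc p) X (h p c)"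
    and hbd: "\<And>p X c. singular_chain p X c \<Longrightarrow>
      chain_boundary (Suc p) (h p c) + h (p - Suc 0) (chain_boundary p c) = singular_subdivision p c - c"
    by (rule chain_homotopic_singular_subdivision) blast
  define B where "B d = pairing c (K p (lift_chain p (sd p d))) - pairing c (h p d)" for d
  define b where "b \<tau> = (if singular_simplex p Y \<tau> then B (frag_of \<tau>) else 0)" for \<tau>
  have B_diff: "B (d - e) = B d - B e" for d e
    by (simp add: B_def sd_def singular_subdivision_diff lift_chain_diff K_diff hdiff pairing_diff)
  have B_0: "B 0 = 0" using B_diff[of 0 0] by simp
  have Bb: "B d = pairing b d" if "singular_chain p Y d" for d
    using that unfolding singular_chain_def
  proof (induction d rule: frag_induction)
    case (diff d e)
    then show ?case by (simp only: B_diff pairing_diff)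
  next
    case (one \<tau>)
    then show ?case by (simp add: b_def)
  qed (simp add: B_0)
  have sub: "singular_chain q X d" if "singular_chain q Y d" for q d
    using that unfolding Y_def by (simp add: singular_chain_subtopology)
  show ?thesis
  proof (rule that)
    show "b \<in> singular_cochains p X"
      by (auto simp: singular_cochains_def b_def Y_def singular_simplex_subtopology)
    fix \<sigma> assume \<sigma>: "singular_simplex (Suc p) (subtopology X U) \<sigma>"
    then have \<sigma>Y: "singular_chain (Suc p) Y (frag_of \<sigma>)" by (simp add: singular_chain_of Y_def)
    have \<sigma>X: "singular_simplex (Suc p) X \<sigma>" using \<sigma> by (simp add: singular_simplex_subtopology)
    let ?d = "chain_boundary (Suc p) (frag_of \<sigma>)" and ?s = "sd (Suc p) (frag_of \<sigma>)"
    have d: "singular_chain p Y ?d" using singular_chain_boundary[OF \<sigma>Y] by simp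
    have s: "singular_chain (Suc p) Y ?s" unfolding sd_def by (rule singular_chain_singular_subdivision[OF \<sigma>Y])
    have lift: "singular_chain (Suc p) (realization m Y) (lift_chain (Suc p) ?s)"
      by (rule singular_chain_lift_chain[OF s p])
    have "?s = chain_boundary (Suc (Suc p)) (K (Suc p) (lift_chain (Suc p) ?s)) + K p (lift_chain p (sd p ?d))"
      using K_bd[OF lift]
      by (simp add: chain_map_realization_eval_lift_chain[OF s[unfolded sd_def]] chain_boundary_lift_subdivision[OF \<sigma>Y] sd_def)
    then have "pairing c ?s = pairing c (K p (lift_chain p (sd p ?d)))"
      using pairing_cocycle_boundary[OF c K_chain[OF lift]] by (metis add_0 pairing_add)
    moreover have "pairing c ?s - c \<sigma> = pairing c (h p ?d)"
    proof -
      have "?s - frag_of \<sigma> = chain_boundary (Suc (Suc p)) (h (Suc p) (frag_of \<sigma>)) + h p ?d"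
        using hbd[OF \<sigma>Y] by (simp add: sd_def)
      then have "pairing c (?s - frag_of \<sigma>) = pairing c (h p ?d)"
        using pairing_cocycle_boundary[OF c hchain[OF sub[OF \<sigma>Y]]] by (simp add: pairing_add)
      then show ?thesis by (simp add: pairing_diff)
    qed
    ultimately have "c \<sigma> = B ?d" by (simp add: B_def algebra_simps)
    then show "c \<sigma> = coboundary p X b \<sigma>"
      by (simp add: Bb[OF d] coboundary_eq_pairing_boundary[OF \<sigma>X])
  qed
qed

lemma m_categorical_imp_class_vanishes_on:
  fixes u :: "('a, 'r::{comm_ring, comm_monoid_mult}) cochain set"
  assumes cat: "m_categorical m X U" and p: "1 \<le> p" "p \<le> m" and u: "u \<in> cohomology p X"
  obtains a where "a \<in> singular_cocycles p X" "u = cohomology_class p X a"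
    and "\<And>\<sigma>. singular_simplex p (subtopology X U) \<sigma> \<Longrightarrow> a \<sigma> = 0"
proof -
  obtain q where q: "p = Suc q" using p by (cases p) auto
  obtain c where c: "c \<in> singular_cocycles p X" "u = cohomology_class p X c"
    using u unfolding cohomology_def cohomology_class_def by (auto elim: quotientE)
  obtain b where b: "b \<in> singular_cochains q X"
    "\<And>\<sigma>. singular_simplex p (subtopology X U) \<sigma> \<Longrightarrow> c \<sigma> = coboundary q X b \<sigma>"
    using m_categorical_imp_cocycle_coboundary_on[OF cat, of q c] p c(1) unfolding q by blast
  have bd: "coboundary q X b \<in> singular_coboundaries p X"
    using b(1) by (simp add: singular_coboundaries_def q)
  have "coboundary p X (coboundary q X b) = (\<lambda>\<sigma>. 0)"
  proof
    fix \<sigma>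
    show "coboundary p X (coboundary q X b) \<sigma> = 0"
    proof (cases "singular_simplex (Suc p) X \<sigma>")
      case True
      then have \<sigma>: "singular_chain (Suc p) X (frag_of \<sigma>)" by (simp add: singular_chain_of)
      have "singular_chain (Suc q) X (chain_boundary (Suc p) (frag_of \<sigma>))"
        using singular_chain_boundary[OF \<sigma>] q by simp
      then have "pairing (coboundary q X b) (chain_boundary (Suc p) (frag_of \<sigma>))
          = pairing b (chain_boundary (Suc q) (chain_boundary (Suc p) (frag_of \<sigma>)))"
        by (rule pairing_coboundary)
      also have "chain_boundary (Suc q) (chain_boundary (Suc p) (frag_of \<sigma>)) = 0"
        using chain_boundary_boundary_alt[OF \<sigma>] q by simp
      finally show ?thesis by (simp add: coboundary_eq_pairing_boundary[OF True])
    qed (simp add: coboundary_def)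
  qed
  then have cocycle: "(\<lambda>\<sigma>. c \<sigma> - coboundary q X b \<sigma>) \<in> singular_cocycles p X"
    using c(1) by (auto simp: singular_cocycles_def singular_cochains_def coboundary_diff) (auto simp: coboundary_def q)
  then have "(c, \<lambda>\<sigma>. c \<sigma> - coboundary q X b \<sigma>) \<in> cohomologous p X"
    using c(1) bd by (simp add: cohomologous_def)
  then have same_class: "u = cohomology_class p X (\<lambda>\<sigma>. c \<sigma> - coboundary q X b \<sigma>)"
    unfolding c(2) cohomology_class_def by (rule equiv_class_eq[OF equiv_cohomologous])
  show thesis by (rule that[OF cocycle same_class]) (simp add: b(2))
qed

section \<open>Cup products and categorical covers\<close>

text \<open>
  A product of cochains on a simplex involves only values on faces of this simplex, so it vanishes as soon as
  one factor vanishes on the simplices of the set.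
\<close>

lemma cup_list_vanishes_on_categorical_sets:
  fixes us :: "(nat \<times> ('a, 'r::{comm_ring, comm_monoid_mult}) cochain set) list"
  assumes "\<forall>(p, u) \<in> set us. 1 \<le> p \<and> p \<le> m \<and> u \<in> cohomology p X"
    and "\<And>i. i < length us \<Longrightarrow> m_categorical m X (V i)"
  shows "\<exists>c\<in>singular_cocycles (sum_list (map fst us)) X.
    cup_list X us = cohomology_class (sum_list (map fst us)) X c \<and>
    (\<forall>i<length us. \<forall>\<sigma>. singular_simplex (sum_list (map fst us)) (subtopology X (V i)) \<sigma> \<longrightarrow> c \<sigma> = 0)"
  using assms
proof (induction us arbitrary: V)
  case Nil
  show ?case by (intro bexI[of _ "\<lambda>\<sigma>. if singular_simplex 0 X \<sigma> then 1 else 0"]) (simp_all add: unit_class_def unit_cocycle)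
next
  case (Cons pu us)
  obtain p u where pu: "pu = (p, u)" by (cases pu)
  let ?q = "sum_list (map fst us)"
  obtain a where a: "a \<in> singular_cocycles p X" "u = cohomology_class p X a"
    "\<And>\<sigma>. singular_simplex p (subtopology X (V 0)) \<sigma> \<Longrightarrow> a \<sigma> = 0"
    using m_categorical_imp_class_vanishes_on[of m X "V 0" p u] Cons.prems pu by auto
  have "\<forall>(p, u) \<in> set us. 1 \<le> p \<and> p \<le> m \<and> u \<in> cohomology p X" using Cons.prems(1) by simp
  moreover have "\<And>i. i < length us \<Longrightarrow> m_categorical m X (V (Suc i))" using Cons.prems(2) by simp
  ultimately obtain c where c: "c \<in> singular_cocycles ?q X" "cup_list X us = cohomology_class ?q X c"
    "\<And>i \<sigma>. i < length us \<Longrightarrow> singular_simplex ?q (subtopology X (V (Suc i))) \<sigma> \<Longrightarrow> c \<sigma> = 0"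
    using Cons.IH[of "\<lambda>i. V (Suc i)"] by blast
  have zero: "cup_cochain X p ?q a c \<sigma> = 0"
    if i: "i < Suc (length us)" and \<sigma>: "singular_simplex (p + ?q) (subtopology X (V i)) \<sigma>" for i \<sigma>
  proof (cases i)
    case 0
    then have "a (front_face p \<sigma>) = 0" using front_face_simplex[OF \<sigma>, of p] a(3) by simp
    then show ?thesis by (simp add: cup_cochain_def)
  next
    case (Suc j)
    then have "c (back_face p ?q \<sigma>) = 0" using back_face_simplex[OF \<sigma>] c(3)[of j] i by simp
    then show ?thesis by (simp add: cup_cochain_def)
  qed
  show ?case
  proof (intro bexI conjI allI impI)
    show "cup_cochain X p ?q a c \<in> singular_cocycles (sum_list (map fst (pu # us))) X"
      using cup_cocycle[OF a(1) c(1)] by (simp add: pu)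
    show "cup_list X (pu # us) = cohomology_class (sum_list (map fst (pu # us))) X (cup_cochain X p ?q a c)"
      using cup_cohomology_class[OF a(1) c(1)] by (simp add: pu a(2) c(2))
    fix i \<sigma> assume "i < length (pu # us)"
      "singular_simplex (sum_list (map fst (pu # us))) (subtopology X (V i)) \<sigma>"
    then show "cup_cochain X p ?q a c \<sigma> = 0" using zero by (simp add: pu)
  qed
qed

lemma cohomology_class_coboundary:
  assumes "c \<in> singular_cocycles p X" "c \<in> singular_coboundaries p X"
  shows "cohomology_class p X c = zero_class p X"
proof -
  have "(\<lambda>\<sigma>. 0) \<in> singular_cocycles p X" by (simp add: singular_cocycles_def singular_cochains_def)
  then have "(c, \<lambda>\<sigma>. 0) \<in> cohomologous p X" using assms by (simp add: cohomologous_def)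
  then show ?thesis
    unfolding zero_class_def cohomology_class_def by (rule equiv_class_eq[OF equiv_cohomologous])
qed

lemma cup_list_eq_zero_if_longer_than_cover:
  fixes us :: "(nat \<times> ('a, 'r::{comm_ring, comm_monoid_mult}) cochain set) list"
  assumes U: "\<And>i. i \<le> k \<Longrightarrow> openin X (U i) \<and> m_categorical m X (U i)" and cover: "(\<Union>i\<le>k. U i) = topspace X"
    and us: "\<forall>(p, u) \<in> set us. 1 \<le> p \<and> p \<le> m \<and> u \<in> cohomology p X" and len: "k < length us"
  shows "cup_list X us = zero_class (sum_list (map fst us)) X"
proof -
  let ?n = "sum_list (map fst us)"
  \<comment> \<open>There may be more factors than sets, so the last set is repeated.\<close>
  obtain c where c: "c \<in> singular_cocycles ?n X" "cup_list X us = cohomology_class ?n X c"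
    "\<And>i \<sigma>. i < length us \<Longrightarrow> singular_simplex ?n (subtopology X (U (min i k))) \<sigma> \<Longrightarrow> c \<sigma> = 0"
    using cup_list_vanishes_on_categorical_sets[OF us, of "\<lambda>i. U (min i k)"] U by auto
  obtain p u us' where "us = (p, u) # us'" using len by (cases us) auto
  then obtain n where n: "?n = Suc n" using us by (cases p) auto
  have "c \<in> singular_coboundaries (Suc n) X"
  proof (rule cocycle_zero_on_small_simplices_imp_coboundary[of "U ` {..k}"])
    show "openin X V" if "V \<in> U ` {..k}" for V using that U by auto
    show "topspace X \<subseteq> \<Union> (U ` {..k})" using cover by simp
    show "c \<in> singular_cocycles (Suc n) X" using c(1) n by simp
    fix V \<sigma> assume V: "V \<in> U ` {..k}" "singular_simplex (Suc n) (subtopology X V) \<sigma>"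
    then obtain i where "i \<le> k" "V = U i" by auto
    then show "c \<sigma> = 0" using c(3)[of i \<sigma>] len V(2) n by simp
  qed
  then show ?thesis using c(1,2) n by (simp add: cohomology_class_coboundary)
qed

theorem proposition3p14:
  fixes X :: "'a topology" and m :: nat
  assumes "path_connected_space X" and "m \<ge> 1"
  shows "cup_length TYPE('r::{comm_ring, comm_monoid_mult}) m X \<le> m_cat m X"
  unfolding cup_length_def m_cat_def
proof (rule Sup_least, rule Inf_greatest)
  fix l l'
  assume "l \<in> {enat k |k. \<exists>us :: (nat \<times> ('a, 'r) cochain set) list. length us = k \<and>
      (\<forall>(p, u) \<in> set us. 1 \<le> p \<and> p \<le> m \<and> u \<in> cohomology p X) \<and>
      cup_list X us \<noteq> zero_class (sum_list (map fst us)) X}"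
  then obtain us :: "(nat \<times> ('a, 'r) cochain set) list" where l: "l = enat (length us)"
    and us: "\<forall>(p, u) \<in> set us. 1 \<le> p \<and> p \<le> m \<and> u \<in> cohomology p X"
      "cup_list X us \<noteq> zero_class (sum_list (map fst us)) X"
    by blast
  assume "l' \<in> {enat k |k. \<exists>U :: nat \<Rightarrow> 'a set.
      (\<forall>i\<le>k. openin X (U i) \<and> m_categorical m X (U i)) \<and> (\<Union>i\<le>k. U i) = topspace X}"
  then obtain k and U :: "nat \<Rightarrow> 'a set" where l': "l' = enat k"
    and U: "\<And>i. i \<le> k \<Longrightarrow> openin X (U i) \<and> m_categorical m X (U i)" "(\<Union>i\<le>k. U i) = topspace X"
    by blast
  have "\<not> k < length us"
    using cup_list_eq_zero_if_longer_than_cover[OF U us(1)] us(2) by blast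
  then show "l \<le> l'" by (simp add: l l')
qed

end
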